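(* For every integer $k\ge 7$ there exists an integer $n_0=n_0(k)$ such that for all integers $n\ge n_0$, \[\mathrm{ex}_{\mathcal{P}}(n,C_k)\ \ge\ 3n-6-\frac{6\cdot 3^{\log_2 3}\,n}{k^{\log_2 3}}.\]
   Context: Graphs are finite and simple. $C_k$ denotes the cycle on $k$ vertices. For a graph $H$, the planar Turán number $\mathrm{ex}_{\mathcal{P}}(n,H)$ is the maximum number of edges in an $n$-vertex planar graph containing no copy of $H$ as a (not necessarily induced) subgraph. Thus $\mathrm{ex}_{\mathcal{P}}(n,C_k)$ is the maximum number of edges in an $n$-vertex planar graph containing no cycle of length exactly $k$. *)

theory Defs
  imports "HOL-Analysis.Analysis"
begin

text \<open>A graph is a pair of a vertex set and a set of edges, each edge being a set of two vertices.\<close>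

type_synonym 'a graph = "'a set \<times> 'a set set"

abbreviation vertices :: "'a graph \<Rightarrow> 'a set" where
  "vertices G \<equiv> fst G"

abbreviation edges :: "'a graph \<Rightarrow> 'a set set" where
  "edges G \<equiv> snd G"

definition simple_graph :: "'a graph \<Rightarrow> bool" where
  "simple_graph G \<longleftrightarrow> finite (vertices G) \<and> (\<forall>e\<in>edges G. e \<subseteq> vertices G \<and> card e = 2)"

text \<open>Not necessarily induced: edges must map to edges, but non-edges are unconstrained.\<close>

definition contains_copy :: "'a graph \<Rightarrow> 'b graph \<Rightarrow> bool" where
  "contains_copy G H \<longleftrightarrow>
     (\<exists>f. inj_on f (vertices H) \<and> f ` vertices H \<subseteq> vertices G \<and> (\<forall>e\<in>edges H. f ` e \<in> edges G))"

text \<open>This is the cycle on \<open>k\<close> vertices for \<open>k \<ge> 3\<close> only.\<close>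

definition cycle_graph :: "nat \<Rightarrow> nat graph" where
  "cycle_graph k = ({..<k}, (\<lambda>i. {i, (i + 1) mod k}) ` {..<k})"

text \<open>
  Topological drawings in the plane, which is taken to be \<^typ>\<open>complex\<close> as in the library's
  Jordan curve theorem. Vertices are distinct points; an edge is an injective continuous arc
  joining its two end points and meeting no other vertex; two arcs meet only in the images of
  common end vertices.
\<close>

definition plane_drawing :: "'a graph \<Rightarrow> ('a \<Rightarrow> complex) \<Rightarrow> ('a set \<Rightarrow> real \<Rightarrow> complex) \<Rightarrow> bool" where
  "plane_drawing G p \<gamma> \<longleftrightarrow>
     inj_on p (vertices G) \<and>
     (\<forall>e\<in>edges G. arc (\<gamma> e) \<and> {pathstart (\<gamma> e), pathfinish (\<gamma> e)} = p ` e \<and>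
        path_image (\<gamma> e) \<inter> p ` vertices G = p ` e) \<and>
     (\<forall>e\<in>edges G. \<forall>e'\<in>edges G. e \<noteq> e' \<longrightarrow>
        path_image (\<gamma> e) \<inter> path_image (\<gamma> e') \<subseteq> p ` (e \<inter> e'))"

definition planar :: "'a graph \<Rightarrow> bool" where
  "planar G \<longleftrightarrow> (\<exists>p \<gamma>. plane_drawing G p \<gamma>)"

text \<open>
  Up to isomorphism it suffices to consider vertices in \<^typ>\<open>nat\<close>. The set below is always
  finite, and it is nonempty as soon as \<open>H\<close> has an edge, so that \<^const>\<open>Max\<close> is meaningful.
\<close>

definition planar_turan_sizes :: "nat \<Rightarrow> 'b graph \<Rightarrow> nat set" where
  "planar_turan_sizes n H =
     {card (edges G) | G :: nat graph.
        simple_graph G \<and> card (vertices G) = n \<and> planar G \<and> \<not> contains_copy G H}"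

definition planar_turan :: "nat \<Rightarrow> 'b graph \<Rightarrow> nat" where
  "planar_turan n H = Max (planar_turan_sizes n H)"

lemma finite_planar_turan_sizes: "finite (planar_turan_sizes n H)"
proof -
  have "card (edges G) \<le> 2 ^ n" if "simple_graph G" "card (vertices G) = n" for G :: "nat graph"
  proof -
    have "finite (vertices G)" "edges G \<subseteq> Pow (vertices G)"
      using that(1) by (auto simp: simple_graph_def)
    then show ?thesis
      using that(2) card_mono[of "Pow (vertices G)" "edges G"] by (simp add: card_Pow)
  qed
  then have "planar_turan_sizes n H \<subseteq> {..2 ^ n}"
    by (auto simp: planar_turan_sizes_def)
  then show ?thesis
    by (rule finite_subset) simp
qed

lemma planar_turan_sizes_nonempty:
  assumes "edges H \<noteq> {}"
  shows "planar_turan_sizes n H \<noteq> {}"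
proof -
  let ?G = "({..<n}, {}) :: nat graph"
  have "plane_drawing ?G of_nat undefined"
    by (auto simp: plane_drawing_def intro: inj_onI)
  then have "planar ?G"
    by (auto simp: planar_def)
  moreover have "simple_graph ?G" "card (vertices ?G) = n" "\<not> contains_copy ?G H"
    using assms by (auto simp: simple_graph_def contains_copy_def)
  ultimately show ?thesis
    unfolding planar_turan_sizes_def by blast
qed

end

theory Submission
  imports Defs
begin

text \<open>
  Let \<open>t\<close> be such that \<open>3 * 2 ^ t < k \<le> 3 * 2 ^ (t + 1)\<close>; since \<open>k \<ge> 7\<close>, we have \<open>t \<ge> 1\<close>.
  The graph is a book: triangulations that all contain the same two vertices \<open>a\<close> and \<open>b\<close> and are
  otherwise disjoint. Each page is an Apollonian network of depth \<open>t\<close>: start from a triangle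
  \<open>a b c\<close> and, \<open>t\<close> times, put into every inner face a vertex that is joined to the corners of the
  face. Besides \<open>a\<close> and \<open>b\<close> this has \<open>m = (3 ^ t + 1) / 2\<close> vertices. Without the edge \<open>a b\<close> it has
  \<open>3 * m - 1\<close> edges, so that each page loses just one edge against \<open>3 n\<close>. With about \<open>n / m\<close> pages
  the loss stays below \<open>2 * n / 3 ^ t = 6 * n / 3 ^ (t + 1)\<close>, and
  \<open>3 ^ (t + 1) = (2 ^ (t + 1)) powr log 2 3 \<ge> (k / 3) powr log 2 3\<close> makes this the loss that the
  theorem permits (\<open>book_loss_le\<close>, \<open>power_2_powr_log_2_3\<close>). The remainder of \<open>n - 2\<close> modulo \<open>m\<close>
  is filled with isolated vertices, at a constant cost.
  
  Cycles are short because the interior of a page has an elimination tree of height \<open>t\<close>: removing the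
  central vertex separates the interiors of the three networks of depth \<open>t - 1\<close> around it. For a vertex set \<open>X\<close> let
  \<open>N\<close> be the number of vertices of the cycle in \<open>X\<close> and \<open>D\<close> the number of its edges that leave \<open>X\<close>.
  Removing a vertex adds at most two to the total of the \<open>D\<close> over the separated parts
  (\<open>sum_cut_le\<close>), and a part that is visited has \<open>D \<ge> 2\<close>. By induction, a set of height \<open>t\<close> has
  \<open>2 * N \<le> D * (2 ^ t - 1)\<close> (\<open>visits_le_linear\<close>), and looking at the root once more gives
  \<open>2 * N + D \<le> (D + 2) * 2 ^ (t - 1)\<close> (\<open>visits_le\<close>). Removing \<open>a\<close>, \<open>b\<close> and then \<open>c\<close> from each page
  leaves interiors with this bound, and summing over the at most two pages that a cycle can visit shows
  that its length is at most \<open>3 * 2 ^ t\<close> (\<open>length_le_of_pages\<close>), which is less than \<open>k\<close>.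
  
  For planarity, one page is drawn with straight segments, new vertices being placed at centroids
  (\<open>stacked_properties\<close>). Triangles on the same side of a common base overlap, so the pages are images of one flat triangle under shears of the plane along parabolas
  through \<open>a = 0\<close> and \<open>b = 1\<close>, which stack them above each other (\<open>bent_triangles_meet_in_corners\<close>,
  \<open>planar_book\<close>).
\<close>

section \<open>Cycles and elimination trees\<close>

definition separated :: "'a set set \<Rightarrow> 'a set \<Rightarrow> 'a set \<Rightarrow> bool" where
  "separated E A B \<longleftrightarrow> A \<inter> B = {} \<and> (\<forall>x\<in>A. \<forall>y\<in>B. {x, y} \<notin> E)"

lemma separatedI:
  assumes "\<And>x. x \<in> A \<Longrightarrow> x \<notin> B" "\<And>x y. x \<in> A \<Longrightarrow> {x, y} \<in> E \<Longrightarrow> y \<notin> B"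
  shows "separated E A B"
  using assms unfolding separated_def by blast

lemma separated_sym:
  assumes "separated E A B"
  shows "separated E B A"
proof -
  have "{y, x} \<notin> E" if "x \<in> A" "y \<in> B" for x y
    using assms that insert_commute[of y x "{}"] by (auto simp: separated_def)
  then show ?thesis
    using assms unfolding separated_def by blast
qed

text \<open>
  Deleting the root \<open>d\<close> leaves pairwise non-adjacent parts, each with an elimination tree of height
  one less: this is the recursion for treedepth, on the subgraph that \<open>E\<close> induces on \<open>X\<close>.
\<close>

inductive elim_height_le :: "'a set set \<Rightarrow> nat \<Rightarrow> 'a set \<Rightarrow> bool" for E where
  empty: "elim_height_le E 0 {}"
| step: "finite \<A> \<Longrightarrow> pairwise (separated E) \<A> \<Longrightarrow> (\<And>A. A \<in> \<A> \<Longrightarrow> elim_height_le E t A)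
    \<Longrightarrow> elim_height_le E (Suc t) (insert d (\<Union>\<A>))"

lemma elim_height_le_image:
  assumes "elim_height_le E t X" "inj_on h X"
    and "\<And>x y. x \<in> X \<Longrightarrow> y \<in> X \<Longrightarrow> {h x, h y} \<in> E' \<Longrightarrow> {x, y} \<in> E"
  shows "elim_height_le E' t (h ` X)"
  using assms
proof (induction rule: elim_height_le.induct)
  case empty
  show ?case by (simp add: elim_height_le.empty)
next
  case (step \<A> t d)
  have "elim_height_le E' (Suc t) (insert (h d) (\<Union> ((`) h ` \<A>)))"
  proof (rule elim_height_le.step)
    show "finite ((`) h ` \<A>)"
      using step.hyps by simp
    show "pairwise (separated E') ((`) h ` \<A>)"
    proof (rule pairwiseI)
      fix A' B' assume "A' \<in> (`) h ` \<A>" "B' \<in> (`) h ` \<A>" "A' \<noteq> B'"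
      then obtain A B where AB: "A \<in> \<A>" "B \<in> \<A>" "A \<noteq> B" "A' = h ` A" "B' = h ` B"
        by blast
      then have sep: "separated E A B"
        using step.hyps(2) by (auto simp: pairwise_def)
      have "h ` A \<inter> h ` B = h ` (A \<inter> B)"
        using inj_on_image_Int[OF step.prems(1), of A B] AB by blast
      then show "separated E' A' B'"
        using sep AB step.prems(2) unfolding separated_def by blast
    qed
  next
    fix A' assume "A' \<in> (`) h ` \<A>"
    then obtain A where A: "A \<in> \<A>" "A' = h ` A" by blast
    show "elim_height_le E' t A'"
      unfolding A(2)
    proof (rule step.IH[OF A(1)])
      show "inj_on h A"
        by (rule inj_on_subset[OF step.prems(1)]) (use A in auto)
    qed (use A step.prems(2) in auto)
  qed
  then show ?case
    by (simp add: image_Union)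
qed

corollary elim_height_le_cong:
  assumes "elim_height_le E t X"
    and "\<And>x y. x \<in> X \<Longrightarrow> y \<in> X \<Longrightarrow> {x, y} \<in> E' \<Longrightarrow> {x, y} \<in> E"
  shows "elim_height_le E' t X"
  using elim_height_le_image[of E t X "\<lambda>x. x" E'] assms by simp

text \<open>
  A cycle of length \<open>k\<close>, given by its vertices \<open>f 0, \<dots>, f (k - 1)\<close> in cyclic order. Its edges are
  counted by their position, the edge at \<open>i\<close> leading from \<open>f i\<close> to the next vertex, so that they stay
  apart even where two of them join the same vertices.
\<close>

locale cycle_in =
  fixes E :: "'a set set" and k :: nat and f :: "nat \<Rightarrow> 'a"
  assumes k_pos: "0 < k"
    and inj: "inj_on f {..<k}"
    and consecutive: "\<And>i. i < k \<Longrightarrow> {f i, f (Suc i mod k)} \<in> E"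
begin

definition visits :: "'a set \<Rightarrow> nat set" where
  "visits X = {i. i < k \<and> f i \<in> X}"

definition cut :: "'a set \<Rightarrow> nat set" where
  "cut X = {i. i < k \<and> (f i \<in> X) \<noteq> (f (Suc i mod k) \<in> X)}"

lemma finite_visits [simp]: "finite (visits X)"
  by (rule finite_subset[of _ "{..<k}"]) (auto simp: visits_def)

lemma finite_cut [simp]: "finite (cut X)"
  by (rule finite_subset[of _ "{..<k}"]) (auto simp: cut_def)

lemma escape:
  assumes "i < k" "P (f i)" "j < k" "\<not> P (f j)"
  obtains u where "u < k" "P (f u)" "\<not> P (f (Suc u mod k))"
proof -
  have "\<exists>u<k. P (f u) \<and> \<not> P (f (Suc u mod k))"
  proof (rule ccontr)
    assume closed: "\<not> ?thesis"
    have "P (f ((i + n) mod k))" for n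
    proof (induction n)
      case 0
      then show ?case using assms by simp
    next
      case (Suc n)
      have "P (f (Suc ((i + n) mod k) mod k))"
        using closed Suc k_pos by auto
      then show ?case by (simp add: mod_Suc_eq)
    qed
    \<comment> \<open>From \<open>i\<close> it takes \<open>k - i + j\<close> steps around the cycle to reach \<open>j\<close>.\<close>
    from this[of "k - i + j"] show False
      using assms by simp
  qed
  then show thesis using that by blast
qed

text \<open>
  A cycle that enters a set must leave it, and these are two different edges. This is the only
  consequence of connectedness that the counting uses.
\<close>

lemma cut_ge_2:
  assumes "visits X \<noteq> {}" "\<not> f ` {..<k} \<subseteq> X"
  shows "2 \<le> card (cut X)"
proof -
  obtain i j where ij: "i < k" "f i \<in> X" "j < k" "f j \<notin> X"
    using assms by (auto simp: visits_def)
  obtain u where u: "u < k" "f u \<in> X" "f (Suc u mod k) \<notin> X"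
    using escape[of i "\<lambda>x. x \<in> X" j] ij by blast
  obtain v where v: "v < k" "f v \<notin> X" "f (Suc v mod k) \<in> X"
    using escape[of j "\<lambda>x. x \<notin> X" i] ij by blast
  have "{u, v} \<subseteq> cut X" "u \<noteq> v"
    using u v by (auto simp: cut_def)
  then show ?thesis
    using card_mono[of "cut X" "{u, v}"] by simp
qed

lemma card_incident_le_2: "card {i. i < k \<and> (f i = v \<or> f (Suc i mod k) = v)} \<le> 2"
proof -
  let ?A = "{i. i < k \<and> f i = v}" and ?B = "{i. i < k \<and> f (Suc i mod k) = v}"
  have suc_inj: "inj_on (\<lambda>i. Suc i mod k) {..<k}"
    by (rule inj_onI) (auto simp: mod_Suc split: if_splits)
  have "card ?A \<le> Suc 0" "card ?B \<le> Suc 0"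
  proof -
    show "card ?A \<le> Suc 0"
      by (subst card_le_Suc0_iff_eq) (use inj in \<open>auto dest: inj_onD\<close>)
    have "i = j" if "i \<in> ?B" "j \<in> ?B" for i j
    proof -
      have "Suc i mod k = Suc j mod k"
        using that inj_onD[OF inj, of "Suc i mod k" "Suc j mod k"] k_pos by simp
      then show ?thesis
        using that inj_onD[OF suc_inj, of i j] by simp
    qed
    then show "card ?B \<le> Suc 0"
      by (subst card_le_Suc0_iff_eq) auto
  qed
  moreover have "{i. i < k \<and> (f i = v \<or> f (Suc i mod k) = v)} = ?A \<union> ?B" by blast
  ultimately show ?thesis
    using card_Un_le[of ?A ?B] by simp
qed

text \<open>
  An edge of the cycle that leaves a part \<open>A\<close> cannot end in another part, so it leaves
  \<open>S \<union> \<Union>\<A>\<close> altogether or ends in \<open>S\<close>; and only two edges are incident with a given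
  vertex of \<open>S\<close>. Thus each deleted vertex adds at most two crossings to the budget of the parts.
\<close>

lemma sum_cut_le:
  assumes "finite S" "finite \<A>" "pairwise (separated E) \<A>"
  shows "(\<Sum>A\<in>\<A>. card (cut A)) \<le> card (cut (S \<union> \<Union>\<A>)) + 2 * card S"
proof -
  let ?inc = "\<lambda>v. {i. i < k \<and> (f i = v \<or> f (Suc i mod k) = v)}"
  have sepE: False if "A \<in> \<A>" "B \<in> \<A>" "A \<noteq> B" "i < k"
    "f i \<in> A \<and> f (Suc i mod k) \<in> B \<or> f i \<in> B \<and> f (Suc i mod k) \<in> A" for A B i
  proof -
    have "separated E A B" "separated E B A"
      using assms(3) that by (auto simp: pairwise_def)
    then show False
      using consecutive[OF that(4)] that(5) by (auto simp: separated_def insert_commute)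
  qed
  have sepD: False if "A \<in> \<A>" "B \<in> \<A>" "A \<noteq> B" "x \<in> A" "x \<in> B" for A B x
    using assms(3) that by (auto simp: pairwise_def separated_def)
  have "(\<Sum>A\<in>\<A>. card (cut A)) = card (\<Union> (cut ` \<A>))"
  proof (rule card_UN_disjoint[symmetric])
    show "\<forall>A\<in>\<A>. \<forall>B\<in>\<A>. A \<noteq> B \<longrightarrow> cut A \<inter> cut B = {}"
    proof (intro ballI impI equals0I)
      fix A B i assume AB: "A \<in> \<A>" "B \<in> \<A>" "A \<noteq> B" and i: "i \<in> cut A \<inter> cut B"
      then have "i < k" "(f i \<in> A) \<noteq> (f (Suc i mod k) \<in> A)" "(f i \<in> B) \<noteq> (f (Suc i mod k) \<in> B)"
        by (auto simp: cut_def)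
      then show False
        using sepE[OF AB] sepD[OF AB] by blast
    qed
  qed (use assms in auto)
  also have "\<dots> \<le> card (cut (S \<union> \<Union>\<A>) \<union> (\<Union>v\<in>S. ?inc v))"
  proof (rule card_mono)
    show "\<Union> (cut ` \<A>) \<subseteq> cut (S \<union> \<Union>\<A>) \<union> (\<Union>v\<in>S. ?inc v)"
    proof clarify
      fix A i assume A: "A \<in> \<A>" and i: "i \<in> cut A" and no: "i \<notin> (\<Union>v\<in>S. ?inc v)"
      have ik: "i < k" using i by (simp add: cut_def)
      have "f i \<notin> S" "f (Suc i mod k) \<notin> S"
        using no ik by auto
      moreover have "(f i \<in> \<Union>\<A>) \<noteq> (f (Suc i mod k) \<in> \<Union>\<A>)"
      proof
        assume "(f i \<in> \<Union>\<A>) = (f (Suc i mod k) \<in> \<Union>\<A>)"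
        moreover have "f i \<in> A \<and> f (Suc i mod k) \<notin> A \<or> f i \<notin> A \<and> f (Suc i mod k) \<in> A"
          using i unfolding cut_def by blast
        ultimately show False
          using sepE[OF A _ _ ik] A by blast
      qed
      ultimately show "i \<in> cut (S \<union> \<Union>\<A>)"
        using ik by (auto simp: cut_def)
    qed
    show "finite (cut (S \<union> \<Union>\<A>) \<union> (\<Union>v\<in>S. ?inc v))"
      using assms(1) by auto
  qed
  also have "\<dots> \<le> card (cut (S \<union> \<Union>\<A>)) + card (\<Union>v\<in>S. ?inc v)"
    by (rule card_Un_le)
  also have "card (\<Union>v\<in>S. ?inc v) \<le> (\<Sum>v\<in>S. card (?inc v))"
    by (rule card_UN_le[OF assms(1)])
  also have "\<dots> \<le> (\<Sum>v\<in>S. 2)"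
    by (rule sum_mono) (rule card_incident_le_2)
  finally show ?thesis by simp
qed

lemma card_visits_le:
  assumes "finite S" "finite \<A>"
  shows "card (visits (S \<union> \<Union>\<A>)) \<le> card S + (\<Sum>A\<in>\<A>. card (visits A))"
proof -
  have "card (visits (S \<union> \<Union>\<A>)) = card (visits S \<union> \<Union> (visits ` \<A>))"
    by (rule arg_cong[of _ _ card]) (auto simp: visits_def)
  also have "\<dots> \<le> card (visits S) + card (\<Union> (visits ` \<A>))"
    by (rule card_Un_le)
  also have "card (visits S) \<le> card S"
    by (rule card_inj_on_le[of f]) (use inj assms(1) in \<open>auto simp: visits_def inj_on_def\<close>)
  also have "card (\<Union> (visits ` \<A>)) \<le> (\<Sum>A\<in>\<A>. card (visits A))"
    by (rule card_UN_le[OF assms(2)])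
  finally show ?thesis by simp
qed

lemma suc_mod_less: "Suc i mod k < k"
  using k_pos by simp

lemma cut_unvisited:
  assumes "visits X = {}"
  shows "cut X = {}"
proof -
  have "f i \<notin> X" if "i < k" for i
    using assms that unfolding visits_def by blast
  then show ?thesis
    using suc_mod_less unfolding cut_def by blast
qed

lemma cut_whole:
  assumes "f ` {..<k} \<subseteq> X"
  shows "cut X = {}"
proof -
  have "f i \<in> X" if "i < k" for i
    using assms that by blast
  then show ?thesis
    using suc_mod_less unfolding cut_def by blast
qed

text \<open>
  If every part can host only \<open>2 ^ t - 1\<close> vertices of the cycle per pair of crossings, then \<open>\<Union>\<A>\<close>
  together with \<open>d\<close> hosts at most \<open>1 + (D + 2) / 2 * (2 ^ t - 1)\<close>, where \<open>D\<close> is the number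
  of crossings of the whole set.
\<close>

lemma visits_le_step:
  fixes t :: nat
  assumes "finite \<A>" "pairwise (separated E) \<A>"
    and bound: "\<And>A. A \<in> \<A> \<Longrightarrow> 2 * card (visits A) + card (cut A) \<le> card (cut A) * 2 ^ t"
  shows "2 * card (visits (insert d (\<Union>\<A>))) + card (cut (insert d (\<Union>\<A>)))
    \<le> (card (cut (insert d (\<Union>\<A>))) + 2) * 2 ^ t"
proof -
  let ?X = "insert d (\<Union>\<A>)"
  let ?C = "\<Sum>A\<in>\<A>. card (cut A)" and ?N = "\<Sum>A\<in>\<A>. card (visits A)"
  have C: "?C \<le> card (cut ?X) + 2"
    using sum_cut_le[of "{d}" \<A>] assms by simp
  have N: "card (visits ?X) \<le> 1 + ?N"
    using card_visits_le[of "{d}" \<A>] assms by simp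
  \<comment> \<open>The crossing terms on the left turn the factor \<open>2 ^ t\<close> into \<open>2 ^ t - 1\<close>, here \<open>z\<close>.\<close>
  have "(\<Sum>A\<in>\<A>. 2 * card (visits A) + card (cut A)) \<le> (\<Sum>A\<in>\<A>. card (cut A) * 2 ^ t)"
    by (rule sum_mono) (rule bound)
  then have "2 * ?N + ?C \<le> ?C * 2 ^ t"
    by (simp add: sum.distrib sum_distrib_left sum_distrib_right)
  moreover obtain z :: nat where z: "2 ^ t = Suc z"
    using not0_implies_Suc[of "2 ^ t"] by auto
  ultimately have "2 * ?N \<le> ?C * z" by simp
  also have "\<dots> \<le> (card (cut ?X) + 2) * z"
    using C by (rule mult_le_mono1)
  finally show ?thesis
    using N z by simp
qed

text \<open>
  A segment of the cycle through a set of elimination height \<open>t\<close> has at most \<open>2 ^ t - 1\<close> vertices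
  there: its passage through the root splits it in two. The bound is linear in the number of crossings
  because a set that the cycle visits has at least two of them, which pays for the root.
\<close>

lemma visits_le_linear:
  assumes "elim_height_le E t X" "\<not> f ` {..<k} \<subseteq> X"
  shows "2 * card (visits X) + card (cut X) \<le> card (cut X) * 2 ^ t"
  using assms
proof (induction rule: elim_height_le.induct)
  case empty
  have "visits {} = {}" by (simp add: visits_def)
  then show ?case using cut_unvisited[of "{}"] by simp
next
  case (step \<A> t d)
  let ?X = "insert d (\<Union>\<A>)"
  show ?case
  proof (cases "visits ?X = {}")
    case True
    then show ?thesis using cut_unvisited[of ?X] by simp
  next
    case False
    have "\<not> f ` {..<k} \<subseteq> A" if "A \<in> \<A>" for A
      using step.prems that by blast
    then have "2 * card (visits ?X) + card (cut ?X) \<le> (card (cut ?X) + 2) * 2 ^ t"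
      using step.hyps step.IH by (intro visits_le_step) auto
    also have "\<dots> \<le> (2 * card (cut ?X)) * 2 ^ t"
      using cut_ge_2[OF False step.prems] by (intro mult_le_mono1) simp
    finally show ?thesis by simp
  qed
qed

text \<open>
  For more than two crossings this improves on the linear bound: only one segment passes through the
  root, so only one is split in two. The constant 3 below depends on this.
\<close>

lemma visits_le:
  assumes "elim_height_le E (Suc t) X" "\<not> f ` {..<k} \<subseteq> X"
  shows "2 * card (visits X) + card (cut X) \<le> (card (cut X) + 2) * 2 ^ t"
  using assms(1)
proof cases
  case (step \<A> d)
  show ?thesis
    unfolding step(1)
    by (rule visits_le_step) (use step assms(2) in \<open>auto intro!: visits_le_linear\<close>)
qed

text \<open>
  A cycle inside the set has no crossings at all. Descend to the lowest set of the tree that still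
  contains the whole cycle: none of its parts does, so the step bound with \<open>D = 0\<close> applies.
\<close>

lemma length_le_of_subset:
  assumes "elim_height_le E t X" "f ` {..<k} \<subseteq> X"
  shows "k \<le> 2 ^ t"
  using assms
proof (induction rule: elim_height_le.induct)
  case empty
  then show ?case using k_pos by auto
next
  case (step \<A> t d)
  let ?X = "insert d (\<Union>\<A>)"
  show ?case
  proof (cases "\<exists>A\<in>\<A>. f ` {..<k} \<subseteq> A")
    case True
    then show ?thesis using step.IH by fastforce
  next
    case False
    then have "2 * card (visits ?X) + card (cut ?X) \<le> (card (cut ?X) + 2) * 2 ^ t"
      using step.hyps by (intro visits_le_step) (auto intro!: visits_le_linear)
    moreover have "visits ?X = {..<k}" "cut ?X = {}"
      using step.prems cut_whole[of ?X] by (auto simp: visits_def)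
    ultimately show ?thesis by simp
  qed
qed

text \<open>
  For \<open>S = {a, b}\<close> this is the bound for a book with spine \<open>a, b\<close>. The pages share at most four
  crossings, two from each of \<open>a\<close> and \<open>b\<close>. A page visited with two crossings consists of \<open>c\<close> and of
  \<open>X\<close>, which then has at most four crossings and so hosts at most \<open>3 * 2 ^ t - 2\<close> vertices; with \<open>c\<close>
  this makes \<open>3 * 2 ^ t - 1\<close> for each pair of crossings, and there are two such pairs besides \<open>a\<close> and
  \<open>b\<close> themselves.
\<close>

lemma length_le_of_pages:
  assumes "finite S" "card S \<le> 2" "finite \<P>" "pairwise (separated E) \<P>"
    and pages: "\<And>P. P \<in> \<P> \<Longrightarrow> \<exists>c X. P = insert c X \<and> elim_height_le E (Suc t) X"
    and sub: "f ` {..<k} \<subseteq> S \<union> \<Union>\<P>"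
  shows "k \<le> 3 * 2 ^ Suc t"
proof (cases "\<exists>P\<in>\<P>. f ` {..<k} \<subseteq> P")
  case True
  then obtain P where P': "P \<in> \<P>" "f ` {..<k} \<subseteq> P" ..
  from pages[OF P'(1)] obtain c X where P: "P = insert c X" "elim_height_le E (Suc t) X"
    by (elim exE conjE)
  have "elim_height_le E (Suc (Suc t)) (insert c (\<Union>{X}))"
    using P(2) by (intro elim_height_le.step) auto
  then have "k \<le> 2 ^ Suc (Suc t)"
    by (rule length_le_of_subset) (use P P'(2) in simp)
  then show ?thesis by simp
next
  case False
  obtain z :: nat where z: "2 ^ t = Suc z"
    using not0_implies_Suc[of "2 ^ t"] by auto
  have page: "2 * card (visits P) \<le> card (cut P) * (3 * z + 2)" if P: "P \<in> \<P>" for P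
  proof (cases "visits P = {}")
    case True
    then show ?thesis by simp
  next
    case nonempty: False
    from pages[OF P] obtain c X where X: "P = insert c X" "elim_height_le E (Suc t) X"
      by (elim exE conjE)
    have proper: "\<not> f ` {..<k} \<subseteq> P"
      using False P by blast
    have "2 * card (visits X) + card (cut X) \<le> (card (cut X) + 2) * 2 ^ t"
      using X proper by (intro visits_le) auto
    then have "2 * card (visits X) \<le> card (cut X) * z + 2 * Suc z"
      unfolding z by simp
    also have "\<dots> \<le> (card (cut P) + 2) * z + 2 * Suc z"
      using sum_cut_le[of "{c}" "{X}"] X by (intro add_right_mono mult_le_mono1) simp
    finally have "2 * card (visits P) \<le> (card (cut P) + 2) * z + 2 * Suc z + 2"
      using card_visits_le[of "{c}" "{X}"] X by simp
    also have "\<dots> = card (cut P) * z + 2 * (2 * z + 2)" by simp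
    also have "\<dots> \<le> card (cut P) * z + card (cut P) * (2 * z + 2)"
      by (intro add_left_mono mult_le_mono1) (rule cut_ge_2[OF nonempty proper])
    finally show ?thesis by (simp add: algebra_simps)
  qed
  have all: "visits (S \<union> \<Union>\<P>) = {..<k}"
    using sub by (auto simp: visits_def)
  have "2 * k \<le> 4 + (\<Sum>P\<in>\<P>. 2 * card (visits P))"
    using card_visits_le[of S \<P>] assms all by (simp add: sum_distrib_left[symmetric])
  also have "\<dots> \<le> 4 + (\<Sum>P\<in>\<P>. card (cut P) * (3 * z + 2))"
    using page by (intro add_left_mono sum_mono) auto
  also have "\<dots> = 4 + (\<Sum>P\<in>\<P>. card (cut P)) * (3 * z + 2)"
    unfolding sum_distrib_right ..
  also have "\<dots> \<le> 4 + 4 * (3 * z + 2)"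
    using sum_cut_le[of S \<P>] assms cut_whole[OF sub] by (intro add_left_mono mult_le_mono1) simp
  finally show ?thesis
    using z by simp
qed

end

section \<open>Straight-line triangulations by repeated stacking\<close>

text \<open>
  Vertices are their own positions and the convex hull of an edge is its segment, so that a drawing is
  just a pair of sets.
\<close>

definition straight_plane :: "complex set \<Rightarrow> complex set set \<Rightarrow> bool" where
  "straight_plane V F \<longleftrightarrow>
     finite V \<and> (\<forall>e\<in>F. e \<subseteq> V \<and> card e = 2 \<and> convex hull e \<inter> V \<subseteq> e) \<and>
     (\<forall>e\<in>F. \<forall>e'\<in>F. e \<noteq> e' \<longrightarrow> convex hull e \<inter> convex hull e' \<subseteq> e \<inter> e')"

lemma straight_plane_vertices:
  "straight_plane V F \<Longrightarrow> e \<in> F \<Longrightarrow> convex hull e \<inter> V \<subseteq> e"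
  by (simp add: straight_plane_def)

lemma straight_plane_crossing:
  "straight_plane V F \<Longrightarrow> e \<in> F \<Longrightarrow> e' \<in> F \<Longrightarrow> e \<noteq> e' \<Longrightarrow>
    convex hull e \<inter> convex hull e' \<subseteq> e \<inter> e'"
  by (simp add: straight_plane_def)

lemma straight_plane_finite_edges: "straight_plane V F \<Longrightarrow> finite F"
  by (rule finite_subset[of _ "Pow V"]) (auto simp: straight_plane_def)

text \<open>
  Two straight-line drawings in convex regions that overlap in at most a common edge do not interfere:
  a point where edges of both meet lies on the segment from \<open>x\<close> to \<open>y\<close>, which is itself an edge of both
  drawings, so that each drawing leaves only common end points.
\<close>

lemma straight_plane_glue:
  assumes 1: "straight_plane V\<^sub>1 F\<^sub>1" "V\<^sub>1 \<subseteq> R\<^sub>1" "convex R\<^sub>1" "{x, y} \<in> F\<^sub>1"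
    and 2: "straight_plane V\<^sub>2 F\<^sub>2" "V\<^sub>2 \<subseteq> R\<^sub>2" "convex R\<^sub>2" "{x, y} \<in> F\<^sub>2"
    and R: "R\<^sub>1 \<inter> R\<^sub>2 \<subseteq> convex hull {x, y}"
  shows "V\<^sub>1 \<inter> V\<^sub>2 = {x, y}" "F\<^sub>1 \<inter> F\<^sub>2 = {{x, y}}"
    "e \<in> F\<^sub>1 \<Longrightarrow> convex hull e \<inter> V\<^sub>2 \<subseteq> e" "e \<in> F\<^sub>2 \<Longrightarrow> convex hull e \<inter> V\<^sub>1 \<subseteq> e"
    "e \<in> F\<^sub>1 \<Longrightarrow> e' \<in> F\<^sub>2 \<Longrightarrow> e \<noteq> e' \<Longrightarrow> convex hull e \<inter> convex hull e' \<subseteq> e \<inter> e'"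
proof -
  have sub1: "convex hull e \<subseteq> R\<^sub>1" "e \<subseteq> V\<^sub>1" "card e = 2" "convex hull e \<inter> V\<^sub>1 \<subseteq> e" if "e \<in> F\<^sub>1" for e
  proof -
    show e: "e \<subseteq> V\<^sub>1" "card e = 2" "convex hull e \<inter> V\<^sub>1 \<subseteq> e"
      using 1(1) that by (simp_all add: straight_plane_def)
    show "convex hull e \<subseteq> R\<^sub>1"
      using e(1) 1(2) by (intro hull_minimal 1(3)) simp
  qed
  have sub2: "convex hull e \<subseteq> R\<^sub>2" "e \<subseteq> V\<^sub>2" "card e = 2" "convex hull e \<inter> V\<^sub>2 \<subseteq> e" if "e \<in> F\<^sub>2" for e
  proof -
    show e: "e \<subseteq> V\<^sub>2" "card e = 2" "convex hull e \<inter> V\<^sub>2 \<subseteq> e"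
      using 2(1) that by (simp_all add: straight_plane_def)
    show "convex hull e \<subseteq> R\<^sub>2"
      using e(1) 2(2) by (intro hull_minimal 2(3)) simp
  qed
  have cross1: "convex hull e \<inter> convex hull e' \<subseteq> e \<inter> e'" if "e \<in> F\<^sub>1" "e' \<in> F\<^sub>1" "e \<noteq> e'" for e e'
    by (rule straight_plane_crossing[OF 1(1) that])
  have cross2: "convex hull e \<inter> convex hull e' \<subseteq> e \<inter> e'" if "e \<in> F\<^sub>2" "e' \<in> F\<^sub>2" "e \<noteq> e'" for e e'
    by (rule straight_plane_crossing[OF 2(1) that])
  show V: "V\<^sub>1 \<inter> V\<^sub>2 = {x, y}"
  proof
    show "V\<^sub>1 \<inter> V\<^sub>2 \<subseteq> {x, y}"
      using 1(2) 2(2) R sub1(4)[OF 1(4)] by blast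
    show "{x, y} \<subseteq> V\<^sub>1 \<inter> V\<^sub>2"
      using sub1(2)[OF 1(4)] sub2(2)[OF 2(4)] by blast
  qed
  show "F\<^sub>1 \<inter> F\<^sub>2 = {{x, y}}"
  proof
    show "F\<^sub>1 \<inter> F\<^sub>2 \<subseteq> {{x, y}}"
    proof
      fix e assume e: "e \<in> F\<^sub>1 \<inter> F\<^sub>2"
      then have "e \<subseteq> V\<^sub>1 \<inter> V\<^sub>2" "card e = 2"
        using sub1[of e] sub2[of e] by simp_all
      then show "e \<in> {{x, y}}"
        using sub1(3)[OF 1(4)] card_subset_eq[of "{x, y}" e] V by simp
    qed
    show "{{x, y}} \<subseteq> F\<^sub>1 \<inter> F\<^sub>2"
      using 1(4) 2(4) by simp
  qed
  have e1: "convex hull e \<inter> R\<^sub>2 \<subseteq> e \<inter> {x, y}" if "e \<in> F\<^sub>1" "e \<noteq> {x, y}" for e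
    using cross1[OF that(1) 1(4) that(2)] sub1(1)[OF that(1)] R by blast
  have e2: "convex hull e \<inter> R\<^sub>1 \<subseteq> e \<inter> {x, y}" if "e \<in> F\<^sub>2" "e \<noteq> {x, y}" for e
    using cross2[OF that(1) 2(4) that(2)] sub2(1)[OF that(1)] R by blast
  show "convex hull e \<inter> V\<^sub>2 \<subseteq> e" if "e \<in> F\<^sub>1"
    using e1[OF that] sub2(4)[OF 2(4)] 2(2) by (cases "e = {x, y}") (simp, blast)
  show "convex hull e \<inter> V\<^sub>1 \<subseteq> e" if "e \<in> F\<^sub>2"
    using e2[OF that] sub1(4)[OF 1(4)] 1(2) by (cases "e = {x, y}") (simp, blast)
  show "convex hull e \<inter> convex hull e' \<subseteq> e \<inter> e'" if e: "e \<in> F\<^sub>1" "e' \<in> F\<^sub>2" "e \<noteq> e'"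
  proof -
    consider "e = {x, y}" | "e' = {x, y}" | "e \<noteq> {x, y}" "e' \<noteq> {x, y}" by blast
    then show ?thesis
    proof cases
      case 1
      then show ?thesis using cross2[of e e'] e \<open>{x, y} \<in> F\<^sub>2\<close> by simp
    next
      case 2
      then show ?thesis using cross1[of e e'] e \<open>{x, y} \<in> F\<^sub>1\<close> by simp
    next
      case 3
      have "convex hull e \<inter> convex hull e' \<subseteq> e"
        using e1[OF e(1) 3(1)] sub2(1)[OF e(2)] by blast
      moreover have "convex hull e \<inter> convex hull e' \<subseteq> e'"
        using e2[OF e(2) 3(2)] sub1(1)[OF e(1)] by blast
      ultimately show ?thesis by blast
    qed
  qed
qed

definition centroid :: "complex \<Rightarrow> complex \<Rightarrow> complex \<Rightarrow> complex" where
  "centroid a b c = (1/3) *\<^sub>R a + (1/3) *\<^sub>R b + (1/3) *\<^sub>R c"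

lemma centroid_rotate: "centroid b c a = centroid a b c"
  by (simp add: centroid_def)

lemma centroid_in_triangle: "centroid a b c \<in> convex hull {a, b, c}"
  unfolding centroid_def convex_hull_3
  by (rule CollectI, intro exI[of _ "1/3 :: real"]) simp

lemma not_collinear_rotate: "\<not> collinear {a, b, c} \<Longrightarrow> \<not> collinear {b, c, a}"
  by (simp add: insert_commute)

lemma not_collinear_centroid:
  assumes "\<not> collinear {a, b, c}"
  shows "\<not> collinear {a, b, centroid a b c}"
proof
  assume coll: "collinear {a, b, centroid a b c}"
  have ab: "a \<noteq> b"
    using assms by auto
  then obtain u v where uv: "u + v = 1" "centroid a b c = u *\<^sub>R a + v *\<^sub>R b"
    using coll unfolding collinear_3_affine_hull[OF ab] affine_hull_2 by auto
  have "c = 3 *\<^sub>R centroid a b c - a - b"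
    unfolding centroid_def by (simp add: algebra_simps)
  also have "\<dots> = (3 * u - 1) *\<^sub>R a + (3 * v - 1) *\<^sub>R b"
    unfolding uv(2) by (simp add: algebra_simps)
  finally have "c \<in> affine hull {a, b}"
    unfolding affine_hull_2 using uv(1)
    by (intro CollectI exI[of _ "3 * u - 1"] exI[of _ "3 * v - 1"]) auto
  then show False
    using assms collinear_3_affine_hull[OF ab] by simp
qed

lemma adjacent_subtriangles_Int:
  assumes "\<not> collinear {a, b, c}"
  shows "convex hull {a, b, centroid a b c} \<inter> convex hull {b, c, centroid a b c}
    \<subseteq> convex hull {b, centroid a b c}"
proof -
  have aff: "\<not> affine_dependent {a, b, c}" and "a \<noteq> b" "b \<noteq> c" "a \<noteq> c"
    using assms by (auto simp: collinear_3_eq_affine_dependent)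
  then have Int: "{a, b} \<inter> {b, c} = {b}" by auto
  have "convex hull (insert (centroid a b c) {a, b}) \<inter> convex hull (insert (centroid a b c) {b, c})
    = convex hull (insert (centroid a b c) ({a, b} \<inter> {b, c}))"
    by (rule convex_hull_exchange_Int[OF aff centroid_in_triangle]) auto
  then show ?thesis
    unfolding Int by (simp add: insert_commute)
qed

lemma subtriangle_subset: "convex hull {a, b, centroid a b c} \<subseteq> convex hull {a, b, c}"
  by (rule hull_minimal) (use centroid_in_triangle[of a b c] in \<open>auto simp: hull_inc\<close>)

text \<open>
  Placing a new vertex in every inner face and joining it to the three corners of the face, \<open>t\<close> times,
  gives the Apollonian network of depth \<open>t\<close>. The outer face is never subdivided.
\<close>

fun stacked_vertices :: "nat \<Rightarrow> complex \<Rightarrow> complex \<Rightarrow> complex \<Rightarrow> complex set" where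
  "stacked_vertices 0 a b c = {a, b, c}"
| "stacked_vertices (Suc t) a b c = (let d = centroid a b c in
     stacked_vertices t a b d \<union> stacked_vertices t b c d \<union> stacked_vertices t c a d)"

fun stacked_edges :: "nat \<Rightarrow> complex \<Rightarrow> complex \<Rightarrow> complex \<Rightarrow> complex set set" where
  "stacked_edges 0 a b c = {{a, b}, {b, c}, {c, a}}"
| "stacked_edges (Suc t) a b c = (let d = centroid a b c in
     stacked_edges t a b d \<union> stacked_edges t b c d \<union> stacked_edges t c a d)"

lemma straight_plane_triangle:
  assumes "\<not> collinear {a, b, c}"
  shows "straight_plane {a, b, c} {{a, b}, {b, c}, {c, a}}"
proof -
  have aff: "\<not> affine_dependent {a, b, c}" and ne: "a \<noteq> b" "b \<noteq> c" "a \<noteq> c"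
    using assms by (auto simp: collinear_3_eq_affine_dependent)
  have Int: "convex hull S \<inter> convex hull T = convex hull (S \<inter> T)"
    if "S \<subseteq> {a, b, c}" "T \<subseteq> {a, b, c}" for S T
    by (rule convex_hull_Int[symmetric], rule affine_independent_subset[OF aff]) (use that in blast)
  have vertex: "convex hull e \<inter> {a, b, c} \<subseteq> e" if "e \<subseteq> {a, b, c}" for e
  proof
    fix x assume x: "x \<in> convex hull e \<inter> {a, b, c}"
    then have "x \<in> convex hull (e \<inter> {x})"
      using Int[OF that, of "{x}"] by auto
    then show "x \<in> e"
      by (cases "x \<in> e") auto
  qed
  have cross: "convex hull e \<inter> convex hull e' \<subseteq> e \<inter> e'"
    if "e \<in> {{a, b}, {b, c}, {c, a}}" "e' \<in> {{a, b}, {b, c}, {c, a}}" "e \<noteq> e'" for e e'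
  proof -
    have "\<exists>x. e \<inter> e' = {x}" using that ne by auto
    then obtain x where "e \<inter> e' = {x}" ..
    then show ?thesis using Int[of e e'] that by auto
  qed
  show ?thesis
    unfolding straight_plane_def
    using ne cross by (intro conjI ballI impI vertex) auto
qed

lemma stacked_corners: "{a, b, c} \<subseteq> stacked_vertices t a b c"
proof (induction t arbitrary: a b c)
  case (Suc t)
  show ?case
    using Suc[of a b "centroid a b c"] Suc[of b c "centroid a b c"] by (simp add: Let_def)
qed simp

lemma stacked_boundary: "{{a, b}, {b, c}, {c, a}} \<subseteq> stacked_edges t a b c"
proof (induction t arbitrary: a b c)
  case (Suc t)
  show ?case
    using Suc[of a b "centroid a b c"] Suc[of b c "centroid a b c"] Suc[of c a "centroid a b c"]
    by (simp add: Let_def)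
qed simp

lemma stacked_in_triangle: "stacked_vertices t a b c \<subseteq> convex hull {a, b, c}"
proof (induction t arbitrary: a b c)
  case 0
  then show ?case by (simp add: hull_subset)
next
  case (Suc t)
  let ?d = "centroid a b c"
  have "convex hull {b, c, ?d} \<subseteq> convex hull {a, b, c}" "convex hull {c, a, ?d} \<subseteq> convex hull {a, b, c}"
    using subtriangle_subset[of b c a] subtriangle_subset[of c a b]
    by (simp_all add: centroid_rotate[of b c a] centroid_rotate[of a b c] insert_commute)
  then show ?case
    using Suc[of a b ?d] Suc[of b c ?d] Suc[of c a ?d] subtriangle_subset[of a b c]
    by (auto simp: Let_def)
qed

lemma card_Un3_common:
  assumes "finite A" "finite B" "finite C" "card A = n" "card B = n" "card C = n"
    and "card (A \<inter> B) = i" "card (B \<inter> C) = i" "card (C \<inter> A) = i" "card (A \<inter> B \<inter> C) = j"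
  shows "card (A \<union> B \<union> C) + 3 * i = 3 * n + j"
proof -
  have 1: "card A + card B = card (A \<union> B) + i"
    using card_Un_Int[of A B] assms by simp
  have 2: "card (A \<union> B) + card C = card (A \<union> B \<union> C) + card ((A \<union> B) \<inter> C)"
    using card_Un_Int[of "A \<union> B" C] assms by simp
  have "(A \<union> B) \<inter> C = (C \<inter> A) \<union> (B \<inter> C)" "(C \<inter> A) \<inter> (B \<inter> C) = A \<inter> B \<inter> C"
    by auto
  then have 3: "2 * i = card ((A \<union> B) \<inter> C) + j"
    using card_Un_Int[of "C \<inter> A" "B \<inter> C"] assms by simp
  show ?thesis using 1 2 3 assms by simp
qed

text \<open>
  The depth-\<open>t + 1\<close> network consists of three depth-\<open>t\<close> networks glued along the spokes at the
  centroid \<open>d\<close>. Plane drawing, vertex count and the \<open>3 n - 6\<close> edges of a triangulation carry over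
  from the three parts. Deleting \<open>d\<close> separates the interiors of the three parts from each other, which
  is why the elimination height of the interior grows by one per step while the number of vertices
  triples.
\<close>

lemma stacked_properties:
  assumes "\<not> collinear {a, b, c}"
  shows "straight_plane (stacked_vertices t a b c) (stacked_edges t a b c)
    \<and> 2 * card (stacked_vertices t a b c) = 3 ^ t + 5
    \<and> card (stacked_edges t a b c) + 6 = 3 * card (stacked_vertices t a b c)
    \<and> elim_height_le (stacked_edges t a b c) t (stacked_vertices t a b c - {a, b, c})"
  using assms
proof (induction t arbitrary: a b c)
  case 0
  then have "straight_plane {a, b, c} {{a, b}, {b, c}, {c, a}}"
    by (rule straight_plane_triangle)
  moreover have "a \<noteq> b" "b \<noteq> c" "c \<noteq> a"
    using 0 by (auto simp: collinear_3_eq_affine_dependent)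
  ultimately show ?case
    by (auto simp: elim_height_le.empty doubleton_eq_iff card_insert_if)
next
  case (Suc t)
  define d where "d = centroid a b c"
  define V1 V2 V3 where V_defs: "V1 = stacked_vertices t a b d" "V2 = stacked_vertices t b c d"
    "V3 = stacked_vertices t c a d"
  define F1 F2 F3 where F_defs: "F1 = stacked_edges t a b d" "F2 = stacked_edges t b c d"
    "F3 = stacked_edges t c a d"
  let ?V = "V1 \<union> V2 \<union> V3" and ?F = "F1 \<union> F2 \<union> F3"
  have VF: "stacked_vertices (Suc t) a b c = ?V" "stacked_edges (Suc t) a b c = ?F"
    by (simp_all add: Let_def V_defs F_defs d_def)
  note nc1 = Suc.prems
  note nc2 = not_collinear_rotate[OF nc1]
  note nc3 = not_collinear_rotate[OF nc2]
  have d_rot: "centroid b c a = d" "centroid c a b = d"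
    by (simp_all add: d_def centroid_def)
  have n1: "\<not> collinear {a, b, d}" and n2: "\<not> collinear {b, c, d}" and n3: "\<not> collinear {c, a, d}"
    using not_collinear_centroid[OF nc1] not_collinear_centroid[OF nc2] not_collinear_centroid[OF nc3]
    unfolding d_rot d_def[symmetric] by simp_all
  have ne: "a \<noteq> b" "b \<noteq> c" "c \<noteq> a" "a \<noteq> d" "b \<noteq> d" "c \<noteq> d"
    using nc1 n1 n2 by (auto simp: collinear_3_eq_affine_dependent)
  note IH1 = Suc.IH[OF n1, folded V_defs F_defs]
  note IH2 = Suc.IH[OF n2, folded V_defs F_defs]
  note IH3 = Suc.IH[OF n3, folded V_defs F_defs]
  have sp: "straight_plane V1 F1" "straight_plane V2 F2" "straight_plane V3 F3"
    using IH1 IH2 IH3 by auto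
  have fin: "finite V1" "finite V2" "finite V3" "finite F1" "finite F2" "finite F3"
    using sp straight_plane_finite_edges by (auto simp: straight_plane_def)
  have R: "V1 \<subseteq> convex hull {a, b, d}" "V2 \<subseteq> convex hull {b, c, d}" "V3 \<subseteq> convex hull {c, a, d}"
    unfolding V_defs by (rule stacked_in_triangle)+
  have spokes: "{b, d} \<in> F1" "{b, d} \<in> F2" "{c, d} \<in> F2" "{c, d} \<in> F3" "{a, d} \<in> F3" "{a, d} \<in> F1"
    using stacked_boundary[of a b d t] stacked_boundary[of b c d t] stacked_boundary[of c a d t]
    unfolding F_defs by (simp_all add: insert_commute)
  have I: "convex hull {a, b, d} \<inter> convex hull {b, c, d} \<subseteq> convex hull {b, d}"
    "convex hull {b, c, d} \<inter> convex hull {c, a, d} \<subseteq> convex hull {c, d}"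
    "convex hull {c, a, d} \<inter> convex hull {a, b, d} \<subseteq> convex hull {a, d}"
    using adjacent_subtriangles_Int[OF nc1] adjacent_subtriangles_Int[OF nc2]
      adjacent_subtriangles_Int[OF nc3]
    unfolding d_rot d_def[symmetric] by simp_all
  note g12 = straight_plane_glue[OF sp(1) R(1) convex_convex_hull spokes(1) sp(2) R(2) convex_convex_hull spokes(2) I(1)]
  note g23 = straight_plane_glue[OF sp(2) R(2) convex_convex_hull spokes(3) sp(3) R(3) convex_convex_hull spokes(4) I(2)]
  note g31 = straight_plane_glue[OF sp(3) R(3) convex_convex_hull spokes(5) sp(1) R(1) convex_convex_hull spokes(6) I(3)]
  have edge_in: "e \<subseteq> V1" if "e \<in> F1" for e
    using sp(1) that by (simp add: straight_plane_def)
  have edge_in2: "e \<subseteq> V2" if "e \<in> F2" for e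
    using sp(2) that by (simp add: straight_plane_def)
  have edge_in3: "e \<subseteq> V3" if "e \<in> F3" for e
    using sp(3) that by (simp add: straight_plane_def)
  have "straight_plane ?V ?F"
    unfolding straight_plane_def
  proof (intro conjI ballI impI)
    show "finite ?V" using fin by simp
  next
    fix e assume e: "e \<in> ?F"
    show "e \<subseteq> ?V" using e edge_in edge_in2 edge_in3 by blast
    show "card e = 2" using e sp by (auto simp: straight_plane_def)
    have "convex hull e \<inter> V1 \<subseteq> e"
      using e by (elim UnE, elim straight_plane_vertices[OF sp(1)], elim g12(4), elim g31(3))
    moreover have "convex hull e \<inter> V2 \<subseteq> e"
      using e by (elim UnE, elim g12(3), elim straight_plane_vertices[OF sp(2)], elim g23(4))
    moreover have "convex hull e \<inter> V3 \<subseteq> e"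
      using e by (elim UnE, elim g31(4), elim g23(3), elim straight_plane_vertices[OF sp(3)])
    ultimately show "convex hull e \<inter> ?V \<subseteq> e" by blast
  next
    fix e e' assume e: "e \<in> ?F" "e' \<in> ?F" "e \<noteq> e'"
    have flip: "convex hull e \<inter> convex hull e' \<subseteq> e \<inter> e'"
      if "convex hull e' \<inter> convex hull e \<subseteq> e' \<inter> e"
      using that by (simp add: Int_commute)
    consider "e \<in> F1" | "e \<in> F2" | "e \<in> F3"
      using e(1) by blast
    then show "convex hull e \<inter> convex hull e' \<subseteq> e \<inter> e'"
    proof cases
      case 1
      from e(2) show ?thesis
        by (elim UnE) (rule straight_plane_crossing[OF sp(1) 1 _ e(3)] g12(5)[OF 1 _ e(3)]
            flip[OF g31(5)[OF _ 1 e(3)[symmetric]]]; assumption)+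
    next
      case 2
      from e(2) show ?thesis
        by (elim UnE) (rule flip[OF g12(5)[OF _ 2 e(3)[symmetric]]]
            straight_plane_crossing[OF sp(2) 2 _ e(3)] g23(5)[OF 2 _ e(3)]; assumption)+
    next
      case 3
      from e(2) show ?thesis
        by (elim UnE) (rule g31(5)[OF 3 _ e(3)] flip[OF g23(5)[OF _ 3 e(3)[symmetric]]]
            straight_plane_crossing[OF sp(3) 3 _ e(3)]; assumption)+
    qed
  qed
  moreover have cards: "2 * card ?V = 3 ^ Suc t + 5 \<and> card ?F + 6 = 3 * card ?V"
  proof -
    have c: "card V2 = card V1" "card V3 = card V1" "card F2 = card F1" "card F3 = card F1"
      using IH1 IH2 IH3 by simp_all
    have "V1 \<inter> V2 \<inter> V3 = {d}"
      using g12(1) g23(1) ne by auto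
    then have "card ?V + 3 * 2 = 3 * card V1 + 1"
      using g12(1) g23(1) g31(1) fin c ne by (intro card_Un3_common) auto
    moreover have "F1 \<inter> F2 \<inter> F3 = {}"
      using g12(2) g23(2) ne by (auto simp: doubleton_eq_iff)
    then have "card ?F + 3 * 1 = 3 * card F1 + 0"
      using g12(2) g23(2) g31(2) fin c by (intro card_Un3_common) auto
    ultimately show ?thesis
      using IH1 by simp
  qed
  moreover have "elim_height_le ?F (Suc t) (?V - {a, b, c})"
  proof -
    let ?X1 = "V1 - {a, b, d}" and ?X2 = "V2 - {b, c, d}" and ?X3 = "V3 - {c, a, d}"
    have corner: "{a, b, d} \<subseteq> V1" "{b, c, d} \<subseteq> V2" "{c, a, d} \<subseteq> V3"
      unfolding V_defs by (rule stacked_corners)+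
    have no: "x \<notin> V2" "x \<notin> V3" if "x \<in> ?X1" for x
      using that g12(1) g31(1) by blast+
    have no2: "x \<notin> V1" "x \<notin> V3" if "x \<in> ?X2" for x
      using that g12(1) g23(1) by blast+
    have no3: "x \<notin> V1" "x \<notin> V2" if "x \<in> ?X3" for x
      using that g23(1) g31(1) by blast+
    have own: "{x, y} \<in> F1" if "x \<in> ?X1" "{x, y} \<in> ?F" for x y
    proof -
      have "{x, y} \<notin> F2" "{x, y} \<notin> F3"
        using no[OF that(1)] edge_in2[of "{x, y}"] edge_in3[of "{x, y}"] by blast+
      then show ?thesis using that(2) by blast
    qed
    have own2: "{x, y} \<in> F2" if "x \<in> ?X2" "{x, y} \<in> ?F" for x y
    proof -
      have "{x, y} \<notin> F1" "{x, y} \<notin> F3"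
        using no2[OF that(1)] edge_in[of "{x, y}"] edge_in3[of "{x, y}"] by blast+
      then show ?thesis using that(2) by blast
    qed
    have own3: "{x, y} \<in> F3" if "x \<in> ?X3" "{x, y} \<in> ?F" for x y
    proof -
      have "{x, y} \<notin> F1" "{x, y} \<notin> F2"
        using no3[OF that(1)] edge_in[of "{x, y}"] edge_in2[of "{x, y}"] by blast+
      then show ?thesis using that(2) by blast
    qed
    have td: "elim_height_le ?F t ?X1" "elim_height_le ?F t ?X2" "elim_height_le ?F t ?X3"
    proof -
      have *: "elim_height_le F1 t ?X1" "elim_height_le F2 t ?X2" "elim_height_le F3 t ?X3"
        using IH1 IH2 IH3 by blast+
      show "elim_height_le ?F t ?X1"
        by (rule elim_height_le_cong[OF *(1)], rule own)
      show "elim_height_le ?F t ?X2"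
        by (rule elim_height_le_cong[OF *(2)], rule own2)
      show "elim_height_le ?F t ?X3"
        by (rule elim_height_le_cong[OF *(3)], rule own3)
    qed
    have end1: "y \<in> V1" if "x \<in> ?X1" "{x, y} \<in> ?F" for x y
      using edge_in[OF own[OF that]] by simp
    have end2: "y \<in> V2" if "x \<in> ?X2" "{x, y} \<in> ?F" for x y
      using edge_in2[OF own2[OF that]] by simp
    have end3: "y \<in> V3" if "x \<in> ?X3" "{x, y} \<in> ?F" for x y
      using edge_in3[OF own3[OF that]] by simp
    have s12: "separated ?F ?X1 ?X2"
    proof (rule separatedI)
      show "x \<notin> ?X2" if "x \<in> ?X1" for x
        using no(1)[OF that] by blast
      show "y \<notin> ?X2" if "x \<in> ?X1" "{x, y} \<in> ?F" for x y
        using end1[OF that] no2(1)[of y] by blast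
    qed
    have s23: "separated ?F ?X2 ?X3"
    proof (rule separatedI)
      show "x \<notin> ?X3" if "x \<in> ?X2" for x
        using no2(2)[OF that] by blast
      show "y \<notin> ?X3" if "x \<in> ?X2" "{x, y} \<in> ?F" for x y
        using end2[OF that] no3(2)[of y] by blast
    qed
    have s31: "separated ?F ?X3 ?X1"
    proof (rule separatedI)
      show "x \<notin> ?X1" if "x \<in> ?X3" for x
        using no3(1)[OF that] by blast
      show "y \<notin> ?X1" if "x \<in> ?X3" "{x, y} \<in> ?F" for x y
        using end3[OF that] no(2)[of y] by blast
    qed
    have "elim_height_le ?F (Suc t) (insert d (\<Union>{?X1, ?X2, ?X3}))"
    proof (rule elim_height_le.step)
      show "pairwise (separated ?F) {?X1, ?X2, ?X3}"
        by (simp add: pairwise_def s12 s23 s31 separated_sym[OF s12] separated_sym[OF s23]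
            separated_sym[OF s31])
      show "elim_height_le ?F t A" if "A \<in> {?X1, ?X2, ?X3}" for A
        using that by (elim insertE emptyE) (simp_all only: td)
    qed simp
    moreover have "insert d (\<Union>{?X1, ?X2, ?X3}) = ?V - {a, b, c}"
    proof
      show "insert d (\<Union>{?X1, ?X2, ?X3}) \<subseteq> ?V - {a, b, c}"
      proof -
        have "d \<in> V1" "a \<notin> V2" "b \<notin> V3" "c \<notin> V1"
          using g12(1) g23(1) g31(1) corner ne by blast+
        then show ?thesis using ne by auto
      qed
      show "?V - {a, b, c} \<subseteq> insert d (\<Union>{?X1, ?X2, ?X3})"
        by blast
    qed
    ultimately show ?thesis by simp
  qed
  ultimately show ?case
    unfolding VF by blast
qed

section \<open>Lower bounds from arbitrary vertex types\<close>

text \<open>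
  The Turan number quantifies over graphs on natural numbers; every finite graph has a copy there.
\<close>

lemma card_edges_le_planar_turan:
  fixes G :: "'a graph"
  assumes simple: "simple_graph G" and planar: "planar G" and free: "\<not> contains_copy G H"
  shows "card (edges G) \<le> planar_turan (card (vertices G)) H"
proof -
  obtain V E where G: "G = (V, E)" by (cases G)
  have fin: "finite V" and E: "\<And>e. e \<in> E \<Longrightarrow> e \<subseteq> V" "\<And>e. e \<in> E \<Longrightarrow> card e = 2"
    using simple by (auto simp: simple_graph_def G)
  obtain h :: "'a \<Rightarrow> nat" where h: "inj_on h V"
    using finite_imp_inj_to_nat_seg[OF fin] by blast
  define g where "g = inv_into V h"
  have gh: "g (h x) = x" if "x \<in> V" for x
    unfolding g_def by (rule inv_into_f_f[OF h that])
  have gh_image: "g ` h ` e = e" if "e \<subseteq> V" for e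
    unfolding g_def by (rule inv_into_image_cancel[OF h that])
  define G' where "G' = (h ` V, (`) h ` E)"
  have "simple_graph G'"
    unfolding simple_graph_def G'_def
    using fin E by (auto simp: card_image[OF inj_on_subset[OF h]])
  moreover have "card (vertices G') = card V"
    by (simp add: G'_def card_image h)
  moreover have "planar G'"
  proof -
    obtain p \<gamma> where "plane_drawing (V, E) p \<gamma>"
      using planar by (auto simp: planar_def G)
    then have p: "inj_on p V"
      and arcs: "\<And>e. e \<in> E \<Longrightarrow> arc (\<gamma> e) \<and> {pathstart (\<gamma> e), pathfinish (\<gamma> e)} = p ` e \<and>
        path_image (\<gamma> e) \<inter> p ` V = p ` e"
      and cross: "\<And>e e'. e \<in> E \<Longrightarrow> e' \<in> E \<Longrightarrow> e \<noteq> e' \<Longrightarrow>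
        path_image (\<gamma> e) \<inter> path_image (\<gamma> e') \<subseteq> p ` (e \<inter> e')"
      by (simp_all add: plane_drawing_def)
    have pg: "(\<lambda>x. p (g x)) ` h ` e = p ` e" if "e \<subseteq> V" for e
      using gh_image[OF that] by (metis image_image)
    have "plane_drawing G' (\<lambda>x. p (g x)) (\<lambda>e. \<gamma> (g ` e))"
      unfolding plane_drawing_def G'_def fst_conv snd_conv
    proof (intro conjI ballI impI)
      show "inj_on (\<lambda>x. p (g x)) (h ` V)"
        using p gh by (auto simp: inj_on_def)
    next
      fix e' assume "e' \<in> (`) h ` E"
      then obtain e where e: "e \<in> E" "e' = h ` e" by blast
      show "arc (\<gamma> (g ` e'))"
        "{pathstart (\<gamma> (g ` e')), pathfinish (\<gamma> (g ` e'))} = (\<lambda>x. p (g x)) ` e'"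
        "path_image (\<gamma> (g ` e')) \<inter> (\<lambda>x. p (g x)) ` h ` V = (\<lambda>x. p (g x)) ` e'"
        using arcs[OF e(1)] by (simp_all add: e(2) gh_image E(1)[OF e(1)] pg)
    next
      fix e' d' assume "e' \<in> (`) h ` E" "d' \<in> (`) h ` E" "e' \<noteq> d'"
      then obtain e d where ed: "e \<in> E" "e' = h ` e" "d \<in> E" "d' = h ` d" "e \<noteq> d" by blast
      have "e' \<inter> d' = h ` (e \<inter> d)"
        unfolding ed by (rule inj_on_image_Int[symmetric, OF h]) (use E ed in auto)
      moreover have "e \<inter> d \<subseteq> V"
        using E(1)[OF ed(1)] by blast
      ultimately show "path_image (\<gamma> (g ` e')) \<inter> path_image (\<gamma> (g ` d')) \<subseteq> (\<lambda>x. p (g x)) ` (e' \<inter> d')"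
        using cross[OF ed(1,3,5)] by (simp add: pg ed(2,4) gh_image E(1)[OF ed(1)] E(1)[OF ed(3)])
    qed
    then show ?thesis
      unfolding planar_def by blast
  qed
  moreover have "\<not> contains_copy G' H"
  proof
    assume "contains_copy G' H"
    then obtain f where f: "inj_on f (vertices H)" "f ` vertices H \<subseteq> h ` V"
      "\<And>e. e \<in> edges H \<Longrightarrow> f ` e \<in> (`) h ` E"
      unfolding contains_copy_def G'_def by auto
    have "inj_on g (h ` V)"
      using gh by (auto simp: inj_on_def)
    then have "inj_on (g \<circ> f) (vertices H)"
      by (intro comp_inj_on f(1)) (rule inj_on_subset[OF _ f(2)])
    moreover have "(g \<circ> f) ` vertices H \<subseteq> V"
      using image_mono[OF f(2), of g] gh_image[of V] by (simp add: image_comp)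
    moreover have "(g \<circ> f) ` e \<in> E" if e: "e \<in> edges H" for e
    proof -
      obtain e0 where "e0 \<in> E" "f ` e = h ` e0"
        using f(3)[OF e] by blast
      moreover have "(g \<circ> f) ` e = g ` f ` e"
        by (simp only: image_comp)
      ultimately show ?thesis
        using gh_image[OF E(1)] by simp
    qed
    ultimately have "contains_copy G H"
      unfolding contains_copy_def G fst_conv snd_conv by blast
    then show False using free by blast
  qed
  ultimately have "card (edges G') \<in> planar_turan_sizes (card V) H"
    unfolding planar_turan_sizes_def by blast
  then have "card (edges G') \<le> planar_turan (card V) H"
    unfolding planar_turan_def by (intro Max_ge finite_planar_turan_sizes)
  moreover have "card (edges G') = card E"
  proof -
    have "inj_on ((`) h) E"
      by (rule inj_on_subset[OF inj_on_image_Pow[OF h]]) (use E(1) in blast)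
    then show ?thesis by (simp add: G'_def card_image)
  qed
  ultimately show ?thesis by (simp add: G)
qed

section \<open>Bending triangles into disjoint pages\<close>

text \<open>
  Shearing the plane along the parabola \<open>y = i x (1 - x)\<close> fixes the points 0 and 1 and moves everything
  above the open unit interval upwards by a multiple of \<open>x (1 - x)\<close>.
\<close>

definition bend :: "nat \<Rightarrow> complex \<Rightarrow> complex" where
  "bend i z = z + \<i> * of_real (real i * (Re z * (1 - Re z)))"

lemma Re_bend [simp]: "Re (bend i z) = Re z"
  and Im_bend [simp]: "Im (bend i z) = Im z + real i * (Re z * (1 - Re z))"
  by (simp_all add: bend_def)

lemma bend_corner [simp]: "bend i 0 = 0" "bend i 1 = 1"
  by (simp_all add: bend_def)

lemma bend_eq_iff [simp]: "bend i z = bend i w \<longleftrightarrow> z = w"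
  by (auto simp: complex_eq_iff)

lemma inj_bend: "inj (bend i)"
  by (rule injI) simp

lemma continuous_on_bend: "continuous_on S (bend i)"
  unfolding bend_def by (intro continuous_intros)

text \<open>
  With the height 1/8 the triangle with base from 0 to 1 does not rise above \<open>y = x (1 - x) / 2\<close>. So,
  except at 0 and 1, it lies strictly below its next bent copy.
\<close>

definition apex :: complex where
  "apex = Complex (1/2) (1/8)"

lemma not_collinear_apex: "\<not> collinear {0, 1, apex}"
proof -
  have "Im z = 0" if "z \<in> affine hull {0, 1}" for z :: complex
    using that unfolding affine_hull_2 by auto
  then have "apex \<notin> affine hull {0, 1}"
    by (force simp: apex_def)
  then show ?thesis
    using collinear_3_affine_hull[of 0 1 apex] by simp
qed

lemma triangle_below_parabola:
  assumes "z \<in> convex hull {0, 1, apex}"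
  shows "0 \<le> Im z" "2 * Im z \<le> Re z * (1 - Re z)"
proof -
  obtain u v w where uvw: "0 \<le> u" "0 \<le> v" "0 \<le> w" "u + v + w = 1"
    and z: "z = u *\<^sub>R 0 + v *\<^sub>R 1 + w *\<^sub>R apex"
    using assms unfolding convex_hull_3 by blast
  have ReIm: "Re z = v + w / 2" "Im z = w / 8"
    by (simp_all add: z apex_def)
  show "0 \<le> Im z" using ReIm uvw by simp
  have u: "u = 1 - v - w" using uvw by simp
  have "Re z * (1 - Re z) - 2 * Im z = u * v + w * (1 - w) / 4"
    unfolding ReIm u by (simp add: field_simps)
  moreover have "0 \<le> u * v + w * (1 - w) / 4"
    using uvw by (intro add_nonneg_nonneg mult_nonneg_nonneg divide_nonneg_nonneg) auto
  ultimately show "2 * Im z \<le> Re z * (1 - Re z)" by simp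
qed

text \<open>
  At abscissa \<open>x\<close> two different copies are shifted apart by at least \<open>x (1 - x)\<close>, but each has
  extent at most half of that. They can meet only where \<open>x (1 - x) = 0\<close>.
\<close>

lemma bent_triangles_meet_in_corners:
  assumes z: "z \<in> convex hull {0, 1, apex}" and w: "w \<in> convex hull {0, 1, apex}"
    and eq: "bend i z = bend j w" and "i \<noteq> j"
  shows "z = w" "z \<in> {0, 1}"
proof -
  define q where "q = Re z * (1 - Re z)"
  have Re: "Re w = Re z"
    using eq by (metis Re_bend)
  then have Im: "Im z + real i * q = Im w + real j * q"
    using arg_cong[OF eq, of Im] by (simp add: q_def)
  have bounds: "0 \<le> Im z" "2 * Im z \<le> q" "0 \<le> Im w" "2 * Im w \<le> q"
    using triangle_below_parabola[OF z] triangle_below_parabola[OF w] Re by (simp_all add: q_def)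
  have "1 \<le> \<bar>real i - real j\<bar>"
    using \<open>i \<noteq> j\<close> by linarith
  then have "1 * q \<le> \<bar>real i - real j\<bar> * q"
    using bounds by (intro mult_right_mono) auto
  also have "\<dots> = \<bar>(real i - real j) * q\<bar>"
    using bounds by (simp add: abs_mult)
  also have "(real i - real j) * q = Im w - Im z"
    using Im by (simp add: algebra_simps)
  finally have "q \<le> \<bar>Im w - Im z\<bar>" by simp
  then have 0: "Im z = 0" "Im w = 0" "q = 0"
    using bounds by linarith+
  then show "z = w"
    using Re by (simp add: complex_eq_iff)
  show "z \<in> {0, 1}"
    using 0 unfolding q_def by (auto simp: complex_eq_iff)
qed

section \<open>Books of triangulations\<close>

text \<open>
  The page is a plane graph drawn in the flat triangle with base \<open>{0, 1}\<close>; its bent copies are the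
  pages of a book with spine \<open>{0, 1}\<close>. The edge \<open>{0, 1}\<close> itself is left out, as every copy would
  draw it as a different curve.
\<close>

locale page =
  fixes V :: "complex set" and F :: "complex set set"
  assumes plane: "straight_plane V F"
    and in_triangle: "V \<subseteq> convex hull {0, 1, apex}"
    and corners: "{0, 1, apex} \<subseteq> V"
    and base: "{0, 1} \<in> F"
begin

text \<open>
  The isolated vertices on the line \<open>Re z = -1\<close> bring the number of vertices to any prescribed value.
\<close>

definition book_vertices :: "nat \<Rightarrow> nat \<Rightarrow> complex set" where
  "book_vertices s r =
     {0, 1} \<union> (\<Union>i<s. bend i ` (V - {0, 1})) \<union> (\<lambda>j. Complex (-1) (real j)) ` {..<r}"

definition book_edges :: "nat \<Rightarrow> complex set set" where
  "book_edges s = (\<Union>i<s. (`) (bend i) ` (F - {{0, 1}}))"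

lemma finite_V: "finite V"
  using plane by (simp add: straight_plane_def)

lemma edge:
  assumes "e \<in> F"
  shows "e \<subseteq> V" "card e = 2" "convex hull e \<inter> V \<subseteq> e" "convex hull e \<subseteq> convex hull {0, 1, apex}"
proof -
  show e: "e \<subseteq> V" "card e = 2" "convex hull e \<inter> V \<subseteq> e"
    using plane assms by (simp_all add: straight_plane_def)
  show "convex hull e \<subseteq> convex hull {0, 1, apex}"
    using e(1) in_triangle by (intro hull_minimal) auto
qed

lemma finite_F: "finite F"
  by (rule straight_plane_finite_edges[OF plane])

lemma book_edgesE:
  assumes "e' \<in> book_edges s"
  obtains i e where "i < s" "e \<in> F" "e \<noteq> {0, 1}" "e' = bend i ` e"
  using assms unfolding book_edges_def by blast

lemma same_page:
  assumes "x \<in> V - {0, 1}" "y \<in> V" "bend i x = bend j y"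
  shows "i = j" "x = y"
proof -
  have xy: "x \<in> convex hull {0, 1, apex}" "y \<in> convex hull {0, 1, apex}"
    using assms in_triangle by auto
  show "i = j"
  proof (rule ccontr)
    assume "i \<noteq> j"
    from bent_triangles_meet_in_corners(2)[OF xy assms(3) this] assms(1)
    show False by simp
  qed
  then show "x = y"
    using assms(3) by simp
qed

lemma corner_notin_page: "0 \<notin> bend i ` (V - {0, 1})" "1 \<notin> bend i ` (V - {0, 1})"
proof -
  have "bend i x \<noteq> bend i c" if "x \<in> V - {0, 1}" "c \<in> {0, 1}" for x c
    using that by auto
  from this[of _ 0] this[of _ 1]
  show "0 \<notin> bend i ` (V - {0, 1})" "1 \<notin> bend i ` (V - {0, 1})"
    by (auto simp: image_iff)
qed

lemma book_edge_in_page: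
  assumes x: "x \<in> V - {0, 1}" and e: "{bend i x, y} \<in> book_edges s"
  obtains z where "z \<in> V" "y = bend i z" "{x, z} \<in> F"
proof -
  obtain j e where j: "e \<in> F" "{bend i x, y} = bend j ` e"
    using book_edgesE[OF e] by metis
  have "bend i x \<in> bend j ` e" "y \<in> bend j ` e"
    unfolding j(2)[symmetric] by simp_all
  then obtain x' z where xz: "x' \<in> e" "bend i x = bend j x'" "z \<in> e" "y = bend j z"
    by blast
  have "x' \<in> V" "z \<in> V" using xz edge(1)[OF j(1)] by auto
  from same_page[OF x this(1) xz(2)] have *: "i = j" "x = x'" by simp_all
  have "bend j ` {x, z} = bend j ` e"
    using j(2) xz(4) * by simp
  then have "{x, z} = e"
    by (simp only: inj_image_eq_iff[OF inj_bend])
  then show thesis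
    using that[of z] \<open>z \<in> V\<close> xz(4) * j(1) by simp
qed

lemma card_book_vertices: "card (book_vertices s r) = r + 2 + s * (card V - 2)"
proof -
  let ?P = "\<Union>i<s. bend i ` (V - {0, 1})" and ?I = "(\<lambda>j. Complex (-1) (real j)) ` {..<r}"
  have "card ?P = (\<Sum>i<s. card (bend i ` (V - {0, 1})))"
  proof (rule card_UN_disjoint)
    show "\<forall>i\<in>{..<s}. \<forall>j\<in>{..<s}. i \<noteq> j \<longrightarrow> bend i ` (V - {0, 1}) \<inter> bend j ` (V - {0, 1}) = {}"
      using same_page(1) by blast
  qed (use finite_V in auto)
  also have "\<dots> = s * (card V - 2)"
    using corners finite_V
    by (simp add: card_image inj_on_subset[OF inj_bend] card_Diff_subset numeral_2_eq_2)
  finally have P: "card ?P = s * (card V - 2)" .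
  have I: "card ?I = r"
    by (subst card_image) (auto intro: inj_onI)
  have "{0, 1} \<inter> ?P = {}"
    using corner_notin_page by simp
  then have "card ({0, 1} \<union> ?P) = 2 + s * (card V - 2)"
    using finite_V P by (subst card_Un_disjoint) auto
  moreover have "({0, 1} \<union> ?P) \<inter> ?I = {}"
  proof -
    have "Re z \<ge> 0" if "z \<in> V" for z
    proof -
      have "0 \<le> Re z * (1 - Re z)"
        using triangle_below_parabola[of z] in_triangle that by force
      then show ?thesis by (auto simp: zero_le_mult_iff)
    qed
    then have nonneg: "0 \<le> Re z" if "z \<in> {0, 1} \<union> ?P" for z
      using that by auto
    show ?thesis
    proof (rule equals0I)
      fix z assume z: "z \<in> ({0, 1} \<union> ?P) \<inter> ?I"
      then obtain j where "z = Complex (-1) (real j)" by blast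
      then have "Re z = -1" by simp
      then show False using nonneg[of z] z by simp
    qed
  qed
  ultimately show ?thesis
    unfolding book_vertices_def using finite_V I by (subst card_Un_disjoint) auto
qed

lemma card_book_edges: "card (book_edges s) = s * (card F - 1)"
proof -
  have "card (book_edges s) = (\<Sum>i<s. card ((`) (bend i) ` (F - {{0, 1}})))"
    unfolding book_edges_def
  proof (rule card_UN_disjoint)
    show "\<forall>i\<in>{..<s}. \<forall>j\<in>{..<s}. i \<noteq> j \<longrightarrow>
        (`) (bend i) ` (F - {{0, 1}}) \<inter> (`) (bend j) ` (F - {{0, 1}}) = {}"
    proof (intro ballI impI equals0I)
      fix i j e' assume "i \<noteq> j"
        and e': "e' \<in> (`) (bend i) ` (F - {{0, 1}}) \<inter> (`) (bend j) ` (F - {{0, 1}})"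
      then obtain e d where e: "e \<in> F" "e \<noteq> {0, 1}" "d \<in> F" "bend i ` e = bend j ` d"
        by blast
      have "\<not> e \<subseteq> {0, 1}"
        using e(2) edge(2)[OF e(1)] card_subset_eq[of "{0, 1}" e] by auto
      then obtain x where x: "x \<in> e" "x \<in> V - {0, 1}"
        using edge(1)[OF e(1)] by blast
      then obtain y where "y \<in> d" "bend i x = bend j y"
        using e(4) by blast
      then show False
        using same_page(1)[OF x(2), of y i j] edge(1)[OF e(3)] \<open>i \<noteq> j\<close> by blast
    qed
  qed (use finite_F in auto)
  also have "\<dots> = (\<Sum>i<s. card (F - {{0, 1}}))"
    by (intro sum.cong refl card_image) (auto intro!: inj_onI simp: inj_image_eq_iff[OF inj_bend])
  finally show ?thesis
    using base finite_F by simp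
qed

lemma simple_book: "simple_graph (book_vertices s r, book_edges s)"
proof -
  have "finite (book_vertices s r)"
    using finite_V by (simp add: book_vertices_def)
  moreover have "e' \<subseteq> book_vertices s r \<and> card e' = 2" if e': "e' \<in> book_edges s" for e'
  proof -
    obtain i e where e: "i < s" "e \<in> F" "e' = bend i ` e"
      using book_edgesE[OF e'] by metis
    have "bend i z \<in> book_vertices s r" if "z \<in> V" for z
      using that e(1) unfolding book_vertices_def by (cases "z \<in> {0, 1}") auto
    then show ?thesis
      using e edge[OF e(2)] by (auto simp: card_image inj_on_subset[OF inj_bend])
  qed
  ultimately show ?thesis by (simp add: simple_graph_def)
qed

lemma bent_edge_meets_page:
  assumes e: "e \<in> F" and z: "z \<in> convex hull e" and w: "w \<in> convex hull {0, 1, apex}"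
    and eq: "bend i z = bend j w" and ne: "i \<noteq> j"
  shows "w = z" "z \<in> e" "z \<in> {0, 1}"
proof -
  have "z \<in> convex hull {0, 1, apex}"
    using z edge(4)[OF e] by blast
  from bent_triangles_meet_in_corners[OF this w eq ne]
  show "w = z" "z \<in> {0, 1}" by simp_all
  then show "z \<in> e"
    using edge(3)[OF e] z corners by blast
qed

text \<open>
  The arcs are the bent segments. Two of them on the same page meet as the straight segments do;
  on different pages they meet on the spine only, and there only in common end points.
\<close>

lemma planar_book: "planar (book_vertices s r, book_edges s)"
proof -
  have "\<exists>i e. e' \<in> book_edges s \<longrightarrow> i < s \<and> e \<in> F \<and> e \<noteq> {0, 1} \<and> e' = bend i ` e" for e'
    using book_edgesE by metis
  \<comment> \<open>Any choice of a page and a flat preimage for each edge will do.\<close>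
  then obtain pg flat where
    "\<And>e'. e' \<in> book_edges s \<Longrightarrow> pg e' < s \<and> flat e' \<in> F \<and> flat e' \<noteq> {0, 1} \<and> e' = bend (pg e') ` flat e'"
    by metis
  then have pf: "pg e' < s" "flat e' \<in> F" "bend (pg e') ` flat e' = e'" if "e' \<in> book_edges s" for e'
    using that by metis+
  have "\<exists>g. e' \<in> book_edges s \<longrightarrow> arc g \<and> {pathstart g, pathfinish g} = e' \<and>
      path_image g = bend (pg e') ` (convex hull flat e')" for e'
  proof (cases "e' \<in> book_edges s")
    case True
    obtain u v where uv: "flat e' = {u, v}" "u \<noteq> v"
      using edge(2)[OF pf(2)[OF True]] by (auto simp: card_2_iff)
    let ?g = "bend (pg e') \<circ> linepath u v"
    have "arc (linepath u v)" using uv(2) by simp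
    then have "arc ?g"
      unfolding arc_def
      by (auto intro!: path_continuous_image continuous_on_bend comp_inj_on inj_on_subset[OF inj_bend])
    moreover have "{pathstart ?g, pathfinish ?g} = e'"
      using pf(3)[OF True] uv(1) by (simp add: pathstart_compose pathfinish_compose)
    ultimately show ?thesis
      using uv(1) by (intro exI[of _ ?g]) (simp add: path_image_compose segment_convex_hull)
  qed simp
  then obtain \<gamma> where \<gamma>: "\<And>e'. e' \<in> book_edges s \<Longrightarrow> arc (\<gamma> e') \<and> {pathstart (\<gamma> e'), pathfinish (\<gamma> e')} = e' \<and>
      path_image (\<gamma> e') = bend (pg e') ` (convex hull flat e')"
    by metis
  have "plane_drawing (book_vertices s r, book_edges s) (\<lambda>z. z) \<gamma>"
    unfolding plane_drawing_def fst_conv snd_conv image_ident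
  proof (intro conjI ballI impI)
    fix e' assume e': "e' \<in> book_edges s"
    note pfe = pf[OF e']
    show "arc (\<gamma> e')" "{pathstart (\<gamma> e'), pathfinish (\<gamma> e')} = e'"
      using \<gamma>[OF e'] by simp_all
    have "e' \<subseteq> book_vertices s r"
      using simple_book[of s r] e' by (simp add: simple_graph_def)
    moreover have "e' \<subseteq> path_image (\<gamma> e')"
      using \<gamma>[OF e'] image_mono[OF hull_subset[of "flat e'" convex], of "bend (pg e')"]
      by (simp add: pfe(3))
    moreover have "y \<in> e'" if y: "y \<in> path_image (\<gamma> e')" "y \<in> book_vertices s r" for y
    proof -
      obtain z where z: "z \<in> convex hull flat e'" "y = bend (pg e') z"
        using y(1) \<gamma>[OF e'] by auto
      have "y \<notin> (\<lambda>j. Complex (-1) (real j)) ` {..<r}"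
      proof
        assume "y \<in> (\<lambda>j. Complex (-1) (real j)) ` {..<r}"
        then have "Re z = -1" using z(2) by (metis Re_bend complex.sel(1) imageE)
        moreover have "z \<in> convex hull {0, 1, apex}"
          using z(1) edge(4)[OF pfe(2)] by blast
        ultimately show False
          using triangle_below_parabola[of z] by simp
      qed
      then consider "y \<in> {0, 1}" | j where "j < s" "y \<in> bend j ` V"
        using y(2) unfolding book_vertices_def by blast
      then have "\<exists>j. y \<in> bend j ` V"
      proof cases
        case 1
        then have "y = bend 0 y" "y \<in> V" using corners by auto
        then show ?thesis by blast
      qed blast
      then obtain j w where w: "w \<in> V" "y = bend j w" by blast
      have "z \<in> flat e'"
      proof (cases "pg e' = j")
        case True
        then have "z = w" using z(2) w(2) by simp
        then show ?thesis using edge(3)[OF pfe(2)] z(1) w(1) by blast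
      next
        case False
        show ?thesis
          by (rule bent_edge_meets_page(2)[OF pfe(2) z(1) _ _ False, of w])
            (use in_triangle w z(2) in auto)
      qed
      then show ?thesis
        using pfe(3) z(2) by blast
    qed
    ultimately show "path_image (\<gamma> e') \<inter> book_vertices s r = e'" by blast
  next
    fix e' d' assume ed: "e' \<in> book_edges s" "d' \<in> book_edges s" "e' \<noteq> d'"
    note pe = pf[OF ed(1)] and pd = pf[OF ed(2)]
    show "path_image (\<gamma> e') \<inter> path_image (\<gamma> d') \<subseteq> e' \<inter> d'"
    proof
      fix y assume "y \<in> path_image (\<gamma> e') \<inter> path_image (\<gamma> d')"
      then obtain z w where z: "z \<in> convex hull flat e'" "y = bend (pg e') z"
        and w: "w \<in> convex hull flat d'" "y = bend (pg d') w"
        using \<gamma>[OF ed(1)] \<gamma>[OF ed(2)] by auto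
      have "z \<in> flat e' \<and> w \<in> flat d'"
      proof (cases "pg e' = pg d'")
        case True
        then have "z = w" using z(2) w(2) by simp
        moreover have "flat e' \<noteq> flat d'"
          using ed(3) pe(3) pd(3) True by metis
        ultimately show ?thesis
          using straight_plane_crossing[OF plane pe(2) pd(2)] z(1) w(1) by blast
      next
        case False
        have zw: "z \<in> convex hull {0, 1, apex}" "w \<in> convex hull {0, 1, apex}"
          using z(1) w(1) edge(4)[OF pe(2)] edge(4)[OF pd(2)] by blast+
        have eq: "bend (pg e') z = bend (pg d') w"
          using z(2) w(2) by simp
        show ?thesis
          using bent_edge_meets_page(2)[OF pe(2) z(1) zw(2) eq False]
            bent_edge_meets_page(2)[OF pd(2) w(1) zw(1) eq[symmetric] False[symmetric]] by simp
      qed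
      then show "y \<in> e' \<inter> d'"
        using z(2) w(2) pe(3) pd(3) by blast
    qed
  qed simp
  then show ?thesis
    unfolding planar_def by blast
qed

text \<open>
  Isolated vertices lie on no cycle. What remains outside the spine is separated into the pages, each of
  them the bent apex together with a copy of a set of bounded elimination height, so the bound for
  books applies.
\<close>

lemma book_cycle_free:
  assumes td: "elim_height_le F (Suc t) (V - {0, 1, apex})" and k: "3 * 2 ^ Suc t < k"
  shows "\<not> contains_copy (book_vertices s r, book_edges s) (cycle_graph k)"
proof
  assume "contains_copy (book_vertices s r, book_edges s) (cycle_graph k)"
  then obtain f where "inj_on f (vertices (cycle_graph k))"
    and f: "\<And>e. e \<in> edges (cycle_graph k) \<Longrightarrow> f ` e \<in> book_edges s"
    unfolding contains_copy_def snd_conv by blast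
  then have inj: "inj_on f {..<k}"
    by (simp add: cycle_graph_def)
  have step: "{f i, f (Suc i mod k)} \<in> book_edges s" if "i < k" for i
    using f[of "{i, (i + 1) mod k}"] that by (simp add: cycle_graph_def)
  interpret cycle_in "book_edges s" k f
    by unfold_locales (use k inj step in auto)
  define \<P> where "\<P> = (\<lambda>i. bend i ` (V - {0, 1})) ` {..<s}"
  have "k \<le> 3 * 2 ^ Suc t"
  proof (rule length_le_of_pages[of "{0, 1}" \<P>])
    show "finite \<P>" by (simp add: \<P>_def)
    show "pairwise (separated (book_edges s)) \<P>"
    proof (rule pairwiseI)
      fix A B assume "A \<in> \<P>" "B \<in> \<P>" "A \<noteq> B"
      then obtain i j where ij: "A = bend i ` (V - {0, 1})" "B = bend j ` (V - {0, 1})" "i \<noteq> j"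
        unfolding \<P>_def by blast
      have other: "bend i z \<notin> B" if "z \<in> V" for z
      proof
        assume "bend i z \<in> B"
        then obtain w where "w \<in> V - {0, 1}" "bend j w = bend i z"
          unfolding ij by force
        then show False
          using same_page(1)[of w z j i] that ij(3) by simp
      qed
      show "separated (book_edges s) A B"
      proof (rule separatedI)
        show "x \<notin> B" if "x \<in> A" for x
          using that other unfolding ij(1) by blast
        show "y \<notin> B" if xy: "x \<in> A" "{x, y} \<in> book_edges s" for x y
        proof -
          obtain x0 where x0: "x0 \<in> V - {0, 1}" "x = bend i x0"
            using xy(1) unfolding ij(1) by blast
          obtain z where "z \<in> V" "y = bend i z"
            using book_edge_in_page[OF x0(1) xy(2)[unfolded x0(2)]] by metis
          then show ?thesis using other by simp
        qed
      qed
    qed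
    show "\<exists>c X. P = insert c X \<and> elim_height_le (book_edges s) (Suc t) X" if "P \<in> \<P>" for P
    proof -
      obtain i where P: "P = bend i ` (V - {0, 1})"
        using \<open>P \<in> \<P>\<close> unfolding \<P>_def by blast
      have "elim_height_le (book_edges s) (Suc t) (bend i ` (V - {0, 1, apex}))"
      proof (rule elim_height_le_image[OF td])
        show "inj_on (bend i) (V - {0, 1, apex})"
          by (rule inj_on_subset[OF inj_bend]) simp
        fix x y assume x: "x \<in> V - {0, 1, apex}" and e: "{bend i x, bend i y} \<in> book_edges s"
        have "x \<in> V - {0, 1}" using x by blast
        then show "{x, y} \<in> F"
          by (rule book_edge_in_page[OF _ e]) simp
      qed
      moreover have "apex \<in> V - {0, 1}"
        using corners by (simp add: apex_def complex_eq_iff)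
      then have "V - {0, 1} = insert apex (V - {0, 1, apex})" by auto
      then have "P = insert (bend i apex) (bend i ` (V - {0, 1, apex}))"
        unfolding P by (metis image_insert)
      ultimately show ?thesis by blast
    qed
    show "f ` {..<k} \<subseteq> {0, 1} \<union> \<Union>\<P>"
    proof
      fix x assume "x \<in> f ` {..<k}"
      then obtain n where n: "n < k" "x = f n" by auto
      obtain i e where e: "i < s" "e \<in> F" "{f n, f (Suc n mod k)} = bend i ` e"
        using book_edgesE[OF step[OF n(1)]] by metis
      have "x \<in> bend i ` e"
        unfolding e(3)[symmetric] n(2) by simp
      then obtain z where z: "z \<in> V" "x = bend i z"
        using edge(1)[OF e(2)] by blast
      show "x \<in> {0, 1} \<union> \<Union>\<P>"
      proof (cases "z \<in> {0, 1}")
        case True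
        then show ?thesis using z(2) by auto
      next
        case False
        then have "x \<in> bend i ` (V - {0, 1})" using z by blast
        then show ?thesis using e(1) unfolding \<P>_def by blast
      qed
    qed
  qed simp_all
  then show False using k by simp
qed

end

section \<open>Counting edges\<close>

text \<open>
  Besides the spine, a page has \<open>m\<close> vertices and \<open>3 * m - 1\<close> edges: the triangulation has
  \<open>3 * (m + 2) - 6\<close>, and the base is left out. So compared with \<open>3 n\<close> each page costs one edge.
\<close>

lemma planar_turan_cycle_ge_book:
  fixes t k n :: nat
  defines "m \<equiv> (3 ^ Suc t + 1) div 2"
  assumes k: "3 * 2 ^ Suc t < k" and n: "2 \<le> n"
  shows "(n - 2) div m * (3 * m - 1) \<le> planar_turan n (cycle_graph k)"
proof -
  define V F where "V = stacked_vertices (Suc t) 0 1 apex" and "F = stacked_edges (Suc t) 0 1 apex"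
  note props = stacked_properties[OF not_collinear_apex, of "Suc t", folded V_def F_def]
  interpret page V F
  proof
    show "V \<subseteq> convex hull {0, 1, apex}"
      unfolding V_def by (rule stacked_in_triangle)
    show "{0, 1, apex} \<subseteq> V"
      unfolding V_def by (rule stacked_corners)
    show "{0, 1} \<in> F"
      unfolding F_def using stacked_boundary[of 0 1 apex "Suc t"] by simp
  qed (use props in simp)
  have "2 * card V = 3 ^ Suc t + 5" "card F + 6 = 3 * card V"
    using props by simp_all
  moreover have "2 * m = 3 ^ Suc t + 1"
    unfolding m_def by simp
  ultimately have V: "card V - 2 = m" and F: "card F - 1 = 3 * m - 1"
    by linarith+
  let ?G = "(book_vertices ((n - 2) div m) ((n - 2) mod m), book_edges ((n - 2) div m))"
  have "card (vertices ?G) = n"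
    unfolding fst_conv card_book_vertices V using n mod_div_mult_eq[of "n - 2" m] by linarith
  moreover have "card (edges ?G) = (n - 2) div m * (3 * m - 1)"
    unfolding snd_conv card_book_edges F ..
  moreover have "card (edges ?G) \<le> planar_turan (card (vertices ?G)) (cycle_graph k)"
    by (intro card_edges_le_planar_turan simple_book planar_book book_cycle_free[OF _ k])
      (use props in simp)
  ultimately show ?thesis by metis
qed

lemma power_2_powr_log_2_3: "(2 ^ u) powr log 2 3 = (3 :: real) ^ u"
proof -
  have "(2 ^ u) powr log 2 3 = (2 powr log 2 3) powr real u"
    unfolding powr_powr powr_realpow[of 2 u, OF zero_less_numeral, symmetric] by (simp only: mult.commute)
  also have "\<dots> = 3 ^ u"
    by (simp add: powr_realpow)
  finally show ?thesis .
qed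

text \<open>
  One edge is lost per page, that is about \<open>n / m = 2 * n / (M + 1)\<close> in total, which is smaller than
  \<open>2 * n / M\<close> by \<open>n / (m * M)\<close>. For large \<open>n\<close> this margin covers the fewer than \<open>3 * m\<close> edges
  that the isolated vertices cost.
\<close>

lemma book_loss_le:
  fixes m n M :: nat
  assumes M: "2 * m = M + 1" "0 < M" and n: "3 * m * m * M + 2 \<le> n"
  shows "3 * real n - 6 - 2 * real n / real M \<le> real ((n - 2) div m * (3 * m - 1))"
proof -
  define s r where "s = (n - 2) div m" and "r = (n - 2) mod m"
  have m: "0 < m" using M by simp
  have r: "r < m" unfolding r_def using m by simp
  have nsr: "n = r + 2 + s * m"
    unfolding s_def r_def using n by simp
  have "real s * real m \<le> real n"
    unfolding nsr by simp
  then have s: "real s \<le> real n / real m"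
    using m by (simp add: field_simps)
  have "3 * real m * (real m * real M) \<le> real n"
  proof -
    have "real (3 * m * m * M) \<le> real n"
      by (rule of_nat_mono) (use n in simp)
    then show ?thesis by (simp add: mult.assoc)
  qed
  then have "3 * real m \<le> real n / (real m * real M)"
    using m M by (simp add: field_simps)
  also have "\<dots> = 2 * real n / real M - real n / real m"
  proof -
    have "2 * real m - real M = 1" using M(1) by linarith
    then have "real n / (real m * real M) = real n * (2 * real m - real M) / (real m * real M)" by simp
    also have "\<dots> = 2 * real n / real M - real n / real m"
      using m M by (simp add: field_simps)
    finally show ?thesis .
  qed
  finally have "3 * real r + real s \<le> 2 * real n / real M"
    using s r by linarith
  moreover have "real (s * (3 * m - 1)) = 3 * (real s * real m) - real s"
    using m by (simp add: of_nat_diff algebra_simps)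
  moreover have "real n = real r + 2 + real s * real m"
    unfolding nsr by simp
  ultimately show ?thesis
    unfolding s_def[symmetric] by simp
qed

lemma ex_level:
  assumes "7 \<le> (k :: nat)"
  obtains t where "3 * 2 ^ Suc t < k" "k \<le> 3 * 2 ^ Suc (Suc t)"
proof -
  define u where "u = (LEAST u. k \<le> 3 * 2 ^ u)"
  have "k \<le> 3 * 2 ^ k"
    using less_exp[of k] by linarith
  then have u: "k \<le> 3 * 2 ^ u"
    unfolding u_def by (rule LeastI)
  have min: "3 * 2 ^ v < k" if "v < u" for v
    using not_less_Least[of v "\<lambda>u. k \<le> 3 * 2 ^ u"] that unfolding u_def by simp
  have "u \<noteq> 0" "u \<noteq> 1"
    by (rule notI, use u assms in simp)+
  then obtain t where "u = Suc (Suc t)"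
    by (metis One_nat_def not0_implies_Suc)
  then show thesis
    using that[of t] u min[of "Suc t"] by simp
qed

theorem theorem4:
  "\<forall>k::nat. k \<ge> 7 \<longrightarrow> (\<exists>n0::nat. \<forall>n::nat. n \<ge> n0 \<longrightarrow>
     real (planar_turan n (cycle_graph k))
       \<ge> 3 * real n - 6 - 6 * 3 powr (log 2 3) * real n / real k powr (log 2 3))"
proof (intro allI impI)
  fix k :: nat assume "7 \<le> k"
  then obtain t where t: "3 * 2 ^ Suc t < k" "k \<le> 3 * 2 ^ Suc (Suc t)"
    by (rule ex_level)
  define m :: nat where "m = (3 ^ Suc t + 1) div 2"
  have m: "2 * m = 3 ^ Suc t + 1"
    unfolding m_def by simp
  show "\<exists>n0. \<forall>n\<ge>n0. real (planar_turan n (cycle_graph k))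
      \<ge> 3 * real n - 6 - 6 * 3 powr (log 2 3) * real n / real k powr (log 2 3)"
  proof (intro exI allI impI)
    fix n assume n: "3 * m * m * 3 ^ Suc t + 2 \<le> n"
    have "real k \<le> real (3 * 2 ^ Suc (Suc t))"
      using t(2) by (rule of_nat_mono)
    then have "real k powr log 2 3 \<le> (3 * 2 ^ Suc (Suc t)) powr log 2 3"
      by (intro powr_mono2) auto
    also have "\<dots> = 3 powr log 2 3 * 3 ^ Suc (Suc t)"
      by (simp only: powr_mult power_2_powr_log_2_3)
    finally have "6 * 3 powr log 2 3 * real n / (3 powr log 2 3 * 3 ^ Suc (Suc t))
        \<le> 6 * 3 powr log 2 3 * real n / real k powr log 2 3"
      using \<open>7 \<le> k\<close> by (intro divide_left_mono) auto
    moreover have "6 * 3 powr log 2 3 * real n / (3 powr log 2 3 * 3 ^ Suc (Suc t))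
        = 2 * real n / real (3 ^ Suc t)"
      by simp
    moreover have "3 * real n - 6 - 2 * real n / real (3 ^ Suc t) \<le> real ((n - 2) div m * (3 * m - 1))"
      by (rule book_loss_le[OF m _ n]) simp
    moreover have "(n - 2) div m * (3 * m - 1) \<le> planar_turan n (cycle_graph k)"
      unfolding m_def by (rule planar_turan_cycle_ge_book[OF t(1)]) (use n in simp)
    ultimately show "real (planar_turan n (cycle_graph k))
        \<ge> 3 * real n - 6 - 6 * 3 powr (log 2 3) * real n / real k powr (log 2 3)"
      using of_nat_mono[of "(n - 2) div m * (3 * m - 1)" "planar_turan n (cycle_graph k)", where ?'a = real]
      by linarith
  qed
qed

end
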